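(* Let $R$ be a commutative coherent ring. For $M,N\in\mathrm{mod}\,R$, every $T_i^M(N)$ ($i\ge0$) is finitely presented, and for $n\ge1$, $$N\in\mathrm{Filt}_n(\mathrm{gen}_R(M))\iff T_n^M(N)=N.$$ Consequently, $$b_R(M)=\min\{n\ge1:T_n^M(R/\mathrm{Ann}_RM)=R/\mathrm{Ann}_RM\}.$$
   Context: All rings are commutative with identity. A ring is coherent if each of its finitely generated ideals is finitely presented as a module. $\mathrm{mod}\,R$ is the category of finitely presented $R$-modules, abelian for coherent $R$. $\mathrm{Ann}_RM=\{r\in R:rM=0\}$. For $M,N\in\mathrm{mod}\,R$ put $\mathrm{tr}_M(N)=\sum_{f\in\mathrm{Hom}_R(M,N)}f(M)\subseteq N$. Define submodules of $N$ by $T_0^M(N)=0$ and $T_{i+1}^M(N)$ = the inverse image of $\mathrm{tr}_M(N/T_i^M(N))$ under the quotient map $N\to N/T_i^M(N)$. $\mathrm{gen}_R(M)$ is the full subcategory of $\mathrm{mod}\,R$ of quotient objects (in $\mathrm{mod}\,R$) of finite direct sums of copies of $M$. For a subcategory $\mathcal A\subseteq\mathrm{mod}\,R$ containing $0$ and $n\ge1$, $\mathrm{Filt}_n(\mathcal A)$ consists of the $N\in\mathrm{mod}\,R$ admitting a filtration $0=N_0\subseteq N_1\subseteq\cdots\subseteq N_m=N$ in $\mathrm{mod}\,R$ with $m\le n$ and all $N_i/N_{i-1}\in\mathcal A$. Finally $b_R(M)=\min\{m\ge1:R/\mathrm{Ann}_RM\in\mathrm{Filt}_m(\mathrm{gen}_R(M))\}$,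 with $b_R(M)=\infty$ if the set is empty. *)

theory Defs
  imports
    "Jordan_Normal_Form.Missing_VectorSpace"
    "HOL-Algebra.QuotRing"
    "HOL-Library.Extended_Nat"
begin

hide_const (open) Modules.module Modules.module_hom Modules.module.span Module.submodule

text \<open>
  Module records extend ring records, so every module below carries a ring multiplication and a
  unit, which are irrelevant for the module structure and are given arbitrary values.
\<close>

section \<open>Modules\<close>

definition regular_module :: "('a, 'r) ring_scheme \<Rightarrow> ('a, 'a) module" where
  "regular_module R = \<lparr>carrier = carrier R, mult = mult R, one = \<one>\<^bsub>R\<^esub>,
     zero = \<zero>\<^bsub>R\<^esub>, add = add R, smult = mult R\<rparr>"

definition module_power :: "('a, 'b, 'm) module_scheme \<Rightarrow> nat \<Rightarrow> ('a, nat \<Rightarrow> 'b) module" where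
  "module_power M k = \<lparr>carrier = {..<k} \<rightarrow>\<^sub>E carrier M,
     mult = (\<lambda>x y. \<lambda>i\<in>{..<k}. \<zero>\<^bsub>M\<^esub>),
     one = (\<lambda>i\<in>{..<k}. \<zero>\<^bsub>M\<^esub>),
     zero = (\<lambda>i\<in>{..<k}. \<zero>\<^bsub>M\<^esub>),
     add = (\<lambda>x y. \<lambda>i\<in>{..<k}. x i \<oplus>\<^bsub>M\<^esub> y i),
     smult = (\<lambda>r x. \<lambda>i\<in>{..<k}. r \<odot>\<^bsub>M\<^esub> x i)\<rparr>"

definition quotient_module :: "('a, 'b, 'm) module_scheme \<Rightarrow> 'b set \<Rightarrow> ('a, 'b set) module" where
  "quotient_module N K = \<lparr>carrier = a_rcosets\<^bsub>N\<^esub> K,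
     mult = (\<lambda>X Y. K), one = K,
     zero = K,
     add = set_add N,
     smult = (\<lambda>r X. \<Union>x\<in>X. K +>\<^bsub>N\<^esub> (r \<odot>\<^bsub>N\<^esub> x))\<rparr>"

definition annihilator :: "('a, 'r) ring_scheme \<Rightarrow> ('a, 'b, 'm) module_scheme \<Rightarrow> 'a set" where
  "annihilator R M = {r \<in> carrier R. \<forall>x\<in>carrier M. r \<odot>\<^bsub>M\<^esub> x = \<zero>\<^bsub>M\<^esub>}"

text \<open>\<open>M\<close> is finitely presented if there is an exact sequence \<open>R^m \<rightarrow> R^n \<rightarrow> M \<rightarrow> 0\<close>.\<close>

definition finitely_presented ::
    "('a, 'r) ring_scheme \<Rightarrow> ('a, 'b, 'm) module_scheme \<Rightarrow> bool" where
  "finitely_presented R M \<longleftrightarrow> module R M \<and>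
     (\<exists>m n g f. g \<in> module_hom R (module_power (regular_module R) m)
                               (module_power (regular_module R) n)
        \<and> f \<in> module_hom R (module_power (regular_module R) n) M
        \<and> g ` carrier (module_power (regular_module R) m)
            = {x \<in> carrier (module_power (regular_module R) n). f x = \<zero>\<^bsub>M\<^esub>}
        \<and> f ` carrier (module_power (regular_module R) n) = carrier M)"

definition coherent_ring :: "('a, 'r) ring_scheme \<Rightarrow> bool" where
  "coherent_ring R \<longleftrightarrow> cring R \<and>
     (\<forall>S. finite S \<and> S \<subseteq> carrier R \<longrightarrow>
        finitely_presented R ((regular_module R)\<lparr>carrier := Idl\<^bsub>R\<^esub> S\<rparr>))"

section \<open>Traces, generation and filtrations\<close>

text \<open>The sum of the submodules \<open>f(M)\<close> is the submodule generated by their union.\<close>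

definition trace_submodule ::
    "('a, 'r) ring_scheme \<Rightarrow> ('a, 'b, 'm) module_scheme \<Rightarrow> ('a, 'c, 'n) module_scheme \<Rightarrow> 'c set" where
  "trace_submodule R M N = LinearCombinations.module.span R N (\<Union>f\<in>module_hom R M N. f ` carrier M)"

primrec trace_filtration ::
    "('a, 'r) ring_scheme \<Rightarrow> ('a, 'b, 'm) module_scheme \<Rightarrow> ('a, 'c, 'n) module_scheme \<Rightarrow> nat \<Rightarrow> 'c set"
where
  "trace_filtration R M N 0 = {\<zero>\<^bsub>N\<^esub>}"
| "trace_filtration R M N (Suc i) =
     {x \<in> carrier N. trace_filtration R M N i +>\<^bsub>N\<^esub> x
        \<in> trace_submodule R M (quotient_module N (trace_filtration R M N i))}"

text \<open>
  Full subcategories of \<open>mod R\<close> are given by predicates on modules. A quotient object of \<open>X\<close> in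
  \<open>mod R\<close> is a finitely presented module \<open>N\<close> with an epimorphism \<open>X \<rightarrow> N\<close>; epimorphisms of
  \<open>mod R\<close> are the surjective homomorphisms, since cokernels are computed as for all modules.
\<close>

definition gen ::
    "('a, 'r) ring_scheme \<Rightarrow> ('a, 'b, 'm) module_scheme \<Rightarrow> ('a, 'c, 'n) module_scheme \<Rightarrow> bool" where
  "gen R M N \<longleftrightarrow> finitely_presented R N \<and>
     (\<exists>k. \<exists>f\<in>module_hom R (module_power M k) N. f ` carrier (module_power M k) = carrier N)"

text \<open>
  The factors \<open>F (Suc i) / F i\<close> are modules over the type of subsets of \<open>N\<close>, so it is at this
  type that the predicate \<open>A\<close> is needed.
\<close>

definition Filt :: "('a, 'r) ring_scheme \<Rightarrow> nat \<Rightarrow> (('a, 'c set) module \<Rightarrow> bool) \<Rightarrow>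
    ('a, 'c, 'n) module_scheme \<Rightarrow> bool" where
  "Filt R n A N \<longleftrightarrow> finitely_presented R N \<and>
     (\<exists>m F. m \<le> n \<and> F 0 = {\<zero>\<^bsub>N\<^esub>} \<and> F m = carrier N
        \<and> (\<forall>i\<le>m. submodule R (F i) N \<and> finitely_presented R (N\<lparr>carrier := F i\<rparr>))
        \<and> (\<forall>i<m. F i \<subseteq> F (Suc i) \<and> A (quotient_module (N\<lparr>carrier := F (Suc i)\<rparr>) (F i))))"

text \<open>In \<^typ>\<open>enat\<close>, \<^term>\<open>Inf\<close> of a nonempty set is its minimum and \<^prop>\<open>Inf ({}::enat set) = \<infinity>\<close>.\<close>

definition gen_bound :: "('a, 'r) ring_scheme \<Rightarrow> ('a, 'b, 'm) module_scheme \<Rightarrow> enat" where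
  "gen_bound R M = Inf {enat m | m. m \<ge> 1 \<and>
     Filt R m (gen R M) (quotient_module (regular_module R) (annihilator R M))}"

end

theory Submission
  imports Defs
begin

text \<open>
  Over a coherent ring the finitely presented modules are coherent: every homomorphism \<open>R^k \<rightarrow> N\<close> has
  a finitely generated kernel. Consequently, a finitely generated submodule of a finitely presented
  module is finitely presented, so is the quotient by it, and the inverse image of a finitely
  generated submodule under a homomorphism of finitely presented modules is finitely generated
  (lemma \<open>finitely_generated_vimage\<close>).

  The trace \<open>tr\<^sub>M(N)\<close> is a sum over all homomorphisms \<open>M \<rightarrow> N\<close>, usually infinitely many. But \<open>R\<close> is
  commutative, so \<open>Hom(M, N)\<close> is a module, namely the kernel of a homomorphism \<open>N^n \<rightarrow> N^m\<close> given by
  a presentation of \<open>M\<close>, and coherence makes it finitely generated. Finitely many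
  homomorphisms therefore suffice: the trace is the image of a single homomorphism \<open>M^k \<rightarrow> N\<close>
  (lemma \<open>trace_submodule_power_image\<close>). This yields both that the trace is finitely generated and
  that it lies in \<open>gen(M)\<close>. By induction every \<open>T\<^sub>i\<close>, as an inverse image of a trace, is finitely
  generated, hence finitely presented, and \<open>T\<^sub>i\<^sub>+\<^sub>1/T\<^sub>i\<close> is the trace of \<open>M\<close> in \<open>N/T\<^sub>i\<close>.

  So if \<open>T\<^sub>n = N\<close>, then the \<open>T\<^sub>i\<close> themselves are a filtration of length \<open>n\<close> with factors in
  \<open>gen(M)\<close>. Conversely any such filtration \<open>F\<close> satisfies \<open>F\<^sub>i \<subseteq> T\<^sub>i\<close> for all \<open>i\<close>
  (lemma \<open>gen_filtration_step_subset\<close>), so that a filtration of length at most \<open>n\<close> reaching \<open>N\<close> forces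
  \<open>T\<^sub>n = N\<close>. The formula for the bound is the case \<open>N = R/Ann(M)\<close>, which is finitely presented
  because \<open>Ann(M)\<close> is the kernel of \<open>R \<rightarrow> M^n\<close>, \<open>r \<mapsto> (r x\<^sub>1, \<dots>, r x\<^sub>n)\<close>, for generators
  \<open>x\<^sub>1, \<dots>, x\<^sub>n\<close> of \<open>M\<close>.
\<close>

section \<open>Homomorphisms and submodules\<close>

abbreviation hom_kernel ::
    "('a, 'b, 'm) module_scheme \<Rightarrow> ('a, 'c, 'n) module_scheme \<Rightarrow> ('b \<Rightarrow> 'c) \<Rightarrow> 'b set" where
  "hom_kernel M N f \<equiv> {x \<in> carrier M. f x = \<zero>\<^bsub>N\<^esub>}"

lemma homI:
  assumes "\<And>x. x \<in> carrier M \<Longrightarrow> f x \<in> carrier N"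
    and "\<And>x y. x \<in> carrier M \<Longrightarrow> y \<in> carrier M \<Longrightarrow> f (x \<oplus>\<^bsub>M\<^esub> y) = f x \<oplus>\<^bsub>N\<^esub> f y"
    and "\<And>r x. r \<in> carrier R \<Longrightarrow> x \<in> carrier M \<Longrightarrow> f (r \<odot>\<^bsub>M\<^esub> x) = r \<odot>\<^bsub>N\<^esub> f x"
  shows "f \<in> module_hom R M N"
  using assms by (auto simp: LinearCombinations.module_hom_def)

lemma hom_in_carrier:
  "f \<in> module_hom R M N \<Longrightarrow> x \<in> carrier M \<Longrightarrow> f x \<in> carrier N"
  by (auto simp: LinearCombinations.module_hom_def)

lemma hom_add:
  "f \<in> module_hom R M N \<Longrightarrow> x \<in> carrier M \<Longrightarrow> y \<in> carrier M
    \<Longrightarrow> f (x \<oplus>\<^bsub>M\<^esub> y) = f x \<oplus>\<^bsub>N\<^esub> f y"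
  by (auto simp: LinearCombinations.module_hom_def)

lemma hom_smult:
  "f \<in> module_hom R M N \<Longrightarrow> r \<in> carrier R \<Longrightarrow> x \<in> carrier M
    \<Longrightarrow> f (r \<odot>\<^bsub>M\<^esub> x) = r \<odot>\<^bsub>N\<^esub> f x"
  by (auto simp: LinearCombinations.module_hom_def)

lemma hom_zero:
  "module R M \<Longrightarrow> module R N \<Longrightarrow> f \<in> module_hom R M N \<Longrightarrow> f \<zero>\<^bsub>M\<^esub> = \<zero>\<^bsub>N\<^esub>"
  by (rule mod_hom.f0_is_0) (simp add: mod_hom_def mod_hom_axioms_def)

lemma hom_minus:
  "module R M \<Longrightarrow> module R N \<Longrightarrow> f \<in> module_hom R M N \<Longrightarrow> x \<in> carrier M \<Longrightarrow> y \<in> carrier M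
    \<Longrightarrow> f (x \<ominus>\<^bsub>M\<^esub> y) = f x \<ominus>\<^bsub>N\<^esub> f y"
  by (rule mod_hom.f_minus) (simp_all add: mod_hom_def mod_hom_axioms_def)

lemma hom_compose:
  "f \<in> module_hom R M N \<Longrightarrow> g \<in> module_hom R N P \<Longrightarrow> (\<lambda>x. g (f x)) \<in> module_hom R M P"
  by (auto simp: LinearCombinations.module_hom_def Pi_iff)

lemma hom_id: "(\<lambda>x. x) \<in> module_hom R M M"
  by (auto simp: LinearCombinations.module_hom_def)

lemma hom_plus:
  assumes "module R N" "f \<in> module_hom R M N" "g \<in> module_hom R M N"
  shows "(\<lambda>x. f x \<oplus>\<^bsub>N\<^esub> g x) \<in> module_hom R M N"
proof -
  interpret N: Module.module R N by fact
  show ?thesis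
    by (rule homI)
      (simp_all add: hom_in_carrier[OF assms(2)] hom_in_carrier[OF assms(3)]
        hom_add[OF assms(2)] hom_add[OF assms(3)]
        hom_smult[OF assms(2)] hom_smult[OF assms(3)] N.smult_r_distr N.M.a_ac)
qed

lemma hom_diff:
  assumes "module R N" "f \<in> module_hom R M N" "g \<in> module_hom R M N"
  shows "(\<lambda>x. f x \<ominus>\<^bsub>N\<^esub> g x) \<in> module_hom R M N"
proof -
  interpret N: Module.module R N by fact
  have "(\<lambda>x. \<ominus>\<^bsub>N\<^esub> g x) \<in> module_hom R M N"
    by (rule homI)
      (simp_all add: hom_in_carrier[OF assms(3)] hom_add[OF assms(3)]
        hom_smult[OF assms(3)] N.smult_r_minus N.M.minus_add)
  from hom_plus[OF assms(1,2) this] show ?thesis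
    by (simp add: a_minus_def)
qed

lemma hom_smult_left:
  assumes "module R N" "f \<in> module_hom R M N" "r \<in> carrier R"
  shows "(\<lambda>x. r \<odot>\<^bsub>N\<^esub> f x) \<in> module_hom R M N"
proof -
  interpret N: Module.module R N by fact
  show ?thesis
  proof (rule homI)
    fix s x assume "s \<in> carrier R" "x \<in> carrier M"
    then show "r \<odot>\<^bsub>N\<^esub> f (s \<odot>\<^bsub>M\<^esub> x) = s \<odot>\<^bsub>N\<^esub> (r \<odot>\<^bsub>N\<^esub> f x)"
      by (simp add: hom_smult[OF assms(2)] hom_in_carrier[OF assms(2)] assms(3)
          flip: N.smult_assoc1) (simp add: N.R.m_comm assms(3))
  qed (simp_all add: assms(3) hom_in_carrier[OF assms(2)] hom_add[OF assms(2)]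
      N.smult_r_distr)
qed

lemma submodule_in_carrier: "submodule R K N \<Longrightarrow> x \<in> K \<Longrightarrow> x \<in> carrier N"
  by (auto simp: submodule_def)

lemma module_restrict_carrier: "submodule R K N \<Longrightarrow> module R (N\<lparr>carrier := K\<rparr>)"
  using LinearCombinations.module.submodule_is_module submodule.module by blast

lemma submodule_image:
  assumes "module R M" "module R N" "f \<in> module_hom R M N"
  shows "submodule R (f ` carrier M) N"
proof -
  interpret mod_hom R M N f using assms by (simp add: mod_hom_def mod_hom_axioms_def)
  show ?thesis using im_is_submodule by (simp add: im_def)
qed

text \<open>
  The universal property of the quotient, for an arbitrary surjection in place of the projection.
  It yields the maps between factors of two filtrations, and the homomorphisms out of a module that is
  given by generators and relations.
\<close>

lemma factor_through_surjection:
  assumes M: "module R M" and N: "module R N" and P: "module R P"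
    and q: "q \<in> module_hom R M N" and surj: "q ` carrier M = carrier N"
    and f: "f \<in> module_hom R M P"
    and ker: "\<And>x. x \<in> carrier M \<Longrightarrow> q x = \<zero>\<^bsub>N\<^esub> \<Longrightarrow> f x = \<zero>\<^bsub>P\<^esub>"
  obtains g where "g \<in> module_hom R N P" "\<And>x. x \<in> carrier M \<Longrightarrow> g (q x) = f x"
proof -
  interpret M: Module.module R M by fact
  interpret N: Module.module R N by fact
  interpret P: Module.module R P by fact
  have eq: "f x = f y" if x: "x \<in> carrier M" and y: "y \<in> carrier M" and "q x = q y" for x y
  proof -
    have "q (x \<ominus>\<^bsub>M\<^esub> y) = \<zero>\<^bsub>N\<^esub>"
      using that by (simp add: hom_minus[OF M N q] hom_in_carrier[OF q])
    then have "f x \<ominus>\<^bsub>P\<^esub> f y = \<zero>\<^bsub>P\<^esub>"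
      using ker[of "x \<ominus>\<^bsub>M\<^esub> y"] x y by (simp add: hom_minus[OF M P f])
    then show ?thesis
      using x y by (simp add: hom_in_carrier[OF f])
  qed
  \<comment> \<open>A set-theoretic section \<open>s\<close> of \<open>q\<close> is enough: by \<open>eq\<close>, its choices do not affect \<open>f (s y)\<close>.\<close>
  have "\<forall>y\<in>carrier N. \<exists>x. x \<in> carrier M \<and> q x = y"
    using surj[symmetric] by auto
  then obtain s where s: "\<forall>y\<in>carrier N. s y \<in> carrier M \<and> q (s y) = y"
    by metis
  have g: "f (s (q x)) = f x" if "x \<in> carrier M" for x
    using s that by (intro eq) (simp_all add: hom_in_carrier[OF q])
  have "(\<lambda>y. f (s y)) \<in> module_hom R N P"
  proof (rule homI)
    fix y z assume "y \<in> carrier N" "z \<in> carrier N"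
    then show "f (s (y \<oplus>\<^bsub>N\<^esub> z)) = f (s y) \<oplus>\<^bsub>P\<^esub> f (s z)"
      using s g[of "s y \<oplus>\<^bsub>M\<^esub> s z"]
      by (simp add: hom_add[OF q] hom_add[OF f])
  next
    fix r y assume "r \<in> carrier R" "y \<in> carrier N"
    then show "f (s (r \<odot>\<^bsub>N\<^esub> y)) = r \<odot>\<^bsub>P\<^esub> f (s y)"
      using s g[of "r \<odot>\<^bsub>M\<^esub> s y"]
      by (simp add: hom_smult[OF q] hom_smult[OF f])
  qed (use s in \<open>simp add: hom_in_carrier[OF f]\<close>)
  then show thesis using g that by blast
qed

section \<open>Quotient modules\<close>

lemma carrier_quotient_module: "carrier (quotient_module N K) = (\<lambda>x. K +>\<^bsub>N\<^esub> x) ` carrier N"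
  by (auto simp: quotient_module_def A_RCOSETS_def')

lemma zero_quotient_module [simp]: "\<zero>\<^bsub>quotient_module N K\<^esub> = K"
  by (simp add: quotient_module_def)

context
  fixes R :: "('a, 'r) ring_scheme" and N :: "('a, 'c, 'n) module_scheme" and K
  assumes K: "submodule R K N"
begin

interpretation N: Module.module R N using K by (rule submodule.module)
interpretation K: submodule R K N by (rule K)

lemma abelian_subgroup_submodule: "abelian_subgroup K N"
proof (rule abelian_subgroupI3)
  show "additive_subgroup K N"
  proof (rule additive_subgroupI, rule subgroup.intro)
    \<comment> \<open>Negation is scalar multiplication by \<open>-1\<close>.\<close>
    fix x assume x: "x \<in> K"
    then have "x \<in> carrier N" using K.subset by auto
    then have "(\<ominus>\<^bsub>R\<^esub> \<one>\<^bsub>R\<^esub>) \<odot>\<^bsub>N\<^esub> x = \<ominus>\<^bsub>N\<^esub> x"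
      by (simp add: N.smult_l_minus)
    moreover have "(\<ominus>\<^bsub>R\<^esub> \<one>\<^bsub>R\<^esub>) \<odot>\<^bsub>N\<^esub> x \<in> K" using x by simp
    ultimately show "inv\<^bsub>add_monoid N\<^esub> x \<in> K" by (simp add: a_inv_def)
  qed (use K.subset in auto)
qed (rule N.abelian_group_axioms)

interpretation S: abelian_subgroup K N by (rule abelian_subgroup_submodule)

lemma add_quotient_module:
  assumes "x \<in> carrier N" "y \<in> carrier N"
  shows "(K +>\<^bsub>N\<^esub> x) \<oplus>\<^bsub>quotient_module N K\<^esub> (K +>\<^bsub>N\<^esub> y) = K +>\<^bsub>N\<^esub> (x \<oplus>\<^bsub>N\<^esub> y)"
  using S.a_rcos_sum[OF assms] by (simp add: quotient_module_def)

lemma coset_eq_iff: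
  assumes "x \<in> carrier N" "y \<in> carrier N"
  shows "K +>\<^bsub>N\<^esub> x = K +>\<^bsub>N\<^esub> y \<longleftrightarrow> x \<ominus>\<^bsub>N\<^esub> y \<in> K"
proof -
  have "x \<in> K +>\<^bsub>N\<^esub> y \<longleftrightarrow> x \<ominus>\<^bsub>N\<^esub> y \<in> K"
    using S.a_rcos_module[OF assms(2,1)] by (simp add: a_minus_def)
  then show ?thesis
    using S.a_rcos_self[OF assms(1)] N.a_repr_independence[OF _ assms(2) S.a_subgroup] by metis
qed

lemma coset_eq_zero_iff:
  assumes "x \<in> carrier N"
  shows "K +>\<^bsub>N\<^esub> x = K \<longleftrightarrow> x \<in> K"
proof -
  have "K +>\<^bsub>N\<^esub> \<zero>\<^bsub>N\<^esub> = K" using K.subset by simp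
  then show ?thesis using coset_eq_iff[OF assms, of "\<zero>\<^bsub>N\<^esub>"] assms
    by (simp add: a_minus_def N.M.minus_equality[of "\<zero>\<^bsub>N\<^esub>" "\<zero>\<^bsub>N\<^esub>"])
qed

text \<open>
  Scalar multiplication is defined as a union over all representatives of the coset; they all
  contribute the same coset.
\<close>

lemma smult_quotient_module:
  assumes r: "r \<in> carrier R" and x: "x \<in> carrier N"
  shows "r \<odot>\<^bsub>quotient_module N K\<^esub> (K +>\<^bsub>N\<^esub> x) = K +>\<^bsub>N\<^esub> (r \<odot>\<^bsub>N\<^esub> x)"
proof -
  have "K +>\<^bsub>N\<^esub> (r \<odot>\<^bsub>N\<^esub> y) = K +>\<^bsub>N\<^esub> (r \<odot>\<^bsub>N\<^esub> x)" if y: "y \<in> K +>\<^bsub>N\<^esub> x" for y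
  proof -
    have yN: "y \<in> carrier N" using y S.a_elemrcos_carrier[OF x] by blast
    have "y \<ominus>\<^bsub>N\<^esub> x \<in> K"
      using S.a_rcos_module[OF x yN] y by (simp add: a_minus_def)
    then have "r \<odot>\<^bsub>N\<^esub> (y \<ominus>\<^bsub>N\<^esub> x) \<in> K" using r by simp
    then have "r \<odot>\<^bsub>N\<^esub> y \<ominus>\<^bsub>N\<^esub> r \<odot>\<^bsub>N\<^esub> x \<in> K"
      using r x yN by (simp add: a_minus_def N.smult_r_distr N.smult_r_minus)
    then show ?thesis using r x yN by (simp add: coset_eq_iff)
  qed
  then have "r \<odot>\<^bsub>quotient_module N K\<^esub> (K +>\<^bsub>N\<^esub> x) = (\<Union>y\<in>K +>\<^bsub>N\<^esub> x. K +>\<^bsub>N\<^esub> (r \<odot>\<^bsub>N\<^esub> x))"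
    by (simp add: quotient_module_def)
  also have "\<dots> = K +>\<^bsub>N\<^esub> (r \<odot>\<^bsub>N\<^esub> x)"
    using S.a_rcos_self[OF x] by blast
  finally show ?thesis .
qed

lemma quotient_module_module: "module R (quotient_module N K)"
proof -
  let ?Q = "quotient_module N K"
  have carr: "X \<in> carrier ?Q \<longleftrightarrow> (\<exists>x\<in>carrier N. X = K +>\<^bsub>N\<^esub> x)" for X
    by (auto simp: carrier_quotient_module)
  have zero: "\<zero>\<^bsub>?Q\<^esub> = K +>\<^bsub>N\<^esub> \<zero>\<^bsub>N\<^esub>" using K.subset by simp
  have in_Q: "K +>\<^bsub>N\<^esub> x \<in> carrier ?Q" if "x \<in> carrier N" for x
    using carr that by blast
  note simps = zero add_quotient_module smult_quotient_module
    N.smult_l_distr N.smult_r_distr N.smult_assoc1 N.M.a_ac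
  show ?thesis
  proof (rule module_criteria)
    show "cring R" by (rule N.R.is_cring)
    show "\<zero>\<^bsub>?Q\<^esub> \<in> carrier ?Q" unfolding zero by (simp add: in_Q)
    show "\<forall>v w. v \<in> carrier ?Q \<and> w \<in> carrier ?Q \<longrightarrow> v \<oplus>\<^bsub>?Q\<^esub> w \<in> carrier ?Q"
      by (metis carr add_quotient_module N.M.a_closed)
    show "\<forall>c v. c \<in> carrier R \<and> v \<in> carrier ?Q \<longrightarrow> c \<odot>\<^bsub>?Q\<^esub> v \<in> carrier ?Q"
      by (metis carr smult_quotient_module N.smult_closed)
    show "\<forall>v\<in>carrier ?Q. \<exists>w\<in>carrier ?Q. v \<oplus>\<^bsub>?Q\<^esub> w = \<zero>\<^bsub>?Q\<^esub>"
    proof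
      fix v assume "v \<in> carrier ?Q"
      then obtain x where x: "x \<in> carrier N" "v = K +>\<^bsub>N\<^esub> x" using carr by auto
      then have "v \<oplus>\<^bsub>?Q\<^esub> (K +>\<^bsub>N\<^esub> (\<ominus>\<^bsub>N\<^esub> x)) = \<zero>\<^bsub>?Q\<^esub>"
        by (simp add: add_quotient_module zero N.M.r_neg del: zero_quotient_module)
      with x show "\<exists>w\<in>carrier ?Q. v \<oplus>\<^bsub>?Q\<^esub> w = \<zero>\<^bsub>?Q\<^esub>"
        using in_Q[of "\<ominus>\<^bsub>N\<^esub> x"] by auto
    qed
  qed (clarsimp simp: carr simps simp del: zero_quotient_module)+
qed

lemma quotient_projection: "(\<lambda>x. K +>\<^bsub>N\<^esub> x) \<in> module_hom R N (quotient_module N K)"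
  by (rule homI) (auto simp: carrier_quotient_module add_quotient_module smult_quotient_module)

end


section \<open>Finite powers and free modules\<close>

lemma carrier_module_power: "carrier (module_power M k) = {..<k} \<rightarrow>\<^sub>E carrier M"
  by (simp add: module_power_def)

lemma module_power_apply_simps [simp]:
  "i < k \<Longrightarrow> (x \<oplus>\<^bsub>module_power M k\<^esub> y) i = x i \<oplus>\<^bsub>M\<^esub> y i"
  "i < k \<Longrightarrow> (r \<odot>\<^bsub>module_power M k\<^esub> x) i = r \<odot>\<^bsub>M\<^esub> x i"
  "i < k \<Longrightarrow> \<zero>\<^bsub>module_power M k\<^esub> i = \<zero>\<^bsub>M\<^esub>"
  by (simp_all add: module_power_def)

lemma module_power_component: "x \<in> carrier (module_power M k) \<Longrightarrow> i < k \<Longrightarrow> x i \<in> carrier M"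
  by (auto simp: carrier_module_power)

lemma module_power_eqI:
  assumes "x \<in> carrier (module_power M k)" "y \<in> carrier (module_power M k)"
    and "\<And>i. i < k \<Longrightarrow> x i = y i"
  shows "x = y"
  using assms(1,2) unfolding carrier_module_power by (rule PiE_ext) (simp add: assms(3))

lemma restrict_in_module_power:
  "(\<And>i. i < k \<Longrightarrow> x i \<in> carrier M) \<Longrightarrow> (\<lambda>i\<in>{..<k}. x i) \<in> carrier (module_power M k)"
  by (auto simp: carrier_module_power)

lemma module_power_module:
  assumes "module R M"
  shows "module R (module_power M k)"
proof -
  interpret M: Module.module R M by fact
  let ?P = "module_power M k"
  note comp = module_power_component
  have add: "x \<oplus>\<^bsub>?P\<^esub> y \<in> carrier ?P" if "x \<in> carrier ?P" "y \<in> carrier ?P" for x y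
    using that by (auto simp: module_power_def PiE_iff)
  have smult: "r \<odot>\<^bsub>?P\<^esub> x \<in> carrier ?P" if "r \<in> carrier R" "x \<in> carrier ?P" for r x
    using that by (auto simp: module_power_def PiE_iff)
  have zero: "\<zero>\<^bsub>?P\<^esub> \<in> carrier ?P"
    by (auto simp: module_power_def)
  show ?thesis
  proof (rule module_criteria)
    show "cring R" by (rule M.R.is_cring)
    show "\<forall>v\<in>carrier ?P. \<exists>w\<in>carrier ?P. v \<oplus>\<^bsub>?P\<^esub> w = \<zero>\<^bsub>?P\<^esub>"
    proof
      fix v assume v: "v \<in> carrier ?P"
      let ?w = "\<lambda>i\<in>{..<k}. \<ominus>\<^bsub>M\<^esub> v i"
      have w: "?w \<in> carrier ?P" by (rule restrict_in_module_power) (simp add: comp[OF v])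
      have "v \<oplus>\<^bsub>?P\<^esub> ?w = \<zero>\<^bsub>?P\<^esub>"
        by (rule module_power_eqI[of _ M k]) (simp_all add: add v w zero M.M.r_neg comp[OF v])
      with w show "\<exists>w\<in>carrier ?P. v \<oplus>\<^bsub>?P\<^esub> w = \<zero>\<^bsub>?P\<^esub>" by blast
    qed
    show "\<zero>\<^bsub>?P\<^esub> \<in> carrier ?P" by (rule zero)
    show "\<forall>v w. v \<in> carrier ?P \<and> w \<in> carrier ?P \<longrightarrow> v \<oplus>\<^bsub>?P\<^esub> w \<in> carrier ?P"
      by (simp add: add)
    show "\<forall>c v. c \<in> carrier R \<and> v \<in> carrier ?P \<longrightarrow> c \<odot>\<^bsub>?P\<^esub> v \<in> carrier ?P"
      by (simp add: smult)
  qed (intro allI ballI impI, (elim conjE)?, rule module_power_eqI[of _ M k];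
      simp add: add smult zero comp M.M.a_ac M.smult_l_distr M.smult_r_distr M.smult_assoc1)+
qed

lemma component_hom: "i < k \<Longrightarrow> (\<lambda>x. x i) \<in> module_hom R (module_power M k) M"
  by (rule homI) (simp_all add: module_power_component)

lemma hom_into_module_power:
  assumes "module R M" and "\<And>i. i < k \<Longrightarrow> f i \<in> module_hom R A M"
  shows "(\<lambda>x. \<lambda>i\<in>{..<k}. f i x) \<in> module_hom R A (module_power M k)"
  by (rule homI)
    (auto simp: module_power_def hom_in_carrier[OF assms(2)] hom_add[OF assms(2)]
      hom_smult[OF assms(2)] intro!: restrict_ext)

definition coord_inj :: "('a, 'b, 'm) module_scheme \<Rightarrow> nat \<Rightarrow> nat \<Rightarrow> 'b \<Rightarrow> nat \<Rightarrow> 'b" where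
  "coord_inj M k i x = (\<lambda>j\<in>{..<k}. if j = i then x else \<zero>\<^bsub>M\<^esub>)"

lemma coord_inj_hom:
  assumes "module R M"
  shows "coord_inj M k i \<in> module_hom R M (module_power M k)"
proof -
  interpret M: Module.module R M by fact
  have "(\<lambda>x. if j = i then x else \<zero>\<^bsub>M\<^esub>) \<in> module_hom R M M" for j
    by (rule homI) simp_all
  from hom_into_module_power[OF assms this] show ?thesis
    by (simp add: coord_inj_def[abs_def])
qed

lemma coord_inj_in_carrier:
  "module R M \<Longrightarrow> x \<in> carrier M \<Longrightarrow> coord_inj M k i x \<in> carrier (module_power M k)"
  using hom_in_carrier[OF coord_inj_hom] .

text \<open>
  The vectors of a power are sums of vectors supported at a single coordinate. The proof clears
  the coordinates one at a time, from the last to the first.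
\<close>

lemma module_power_induct [consumes 2, case_names zero inj add]:
  assumes M: "module R M" and z: "z \<in> carrier (module_power M k)"
    and zero: "P \<zero>\<^bsub>module_power M k\<^esub>"
    and inj: "\<And>i x. i < k \<Longrightarrow> x \<in> carrier M \<Longrightarrow> P (coord_inj M k i x)"
    and add: "\<And>x y. x \<in> carrier (module_power M k) \<Longrightarrow> y \<in> carrier (module_power M k)
        \<Longrightarrow> P x \<Longrightarrow> P y \<Longrightarrow> P (x \<oplus>\<^bsub>module_power M k\<^esub> y)"
  shows "P z"
proof -
  interpret M: Module.module R M by fact
  interpret P: Module.module R "module_power M k" by (rule module_power_module[OF M])
  have "P z" if "j \<le> k" "z \<in> carrier (module_power M k)"
    "\<And>i. j \<le> i \<Longrightarrow> i < k \<Longrightarrow> z i = \<zero>\<^bsub>M\<^esub>" for j z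
    using that
  proof (induction j arbitrary: z)
    case 0
    then have "z = \<zero>\<^bsub>module_power M k\<^esub>" by (intro module_power_eqI[of _ M k]) auto
    then show ?case using zero by simp
  next
    case (Suc j)
    let ?y = "\<lambda>i\<in>{..<k}. if i = j then \<zero>\<^bsub>M\<^esub> else z i"
    note z = module_power_component[OF Suc.prems(2)]
    have y: "?y \<in> carrier (module_power M k)"
      by (rule restrict_in_module_power) (simp add: z)
    have zj: "z j \<in> carrier M" using z Suc.prems(1) by simp
    have eq: "z = ?y \<oplus>\<^bsub>module_power M k\<^esub> coord_inj M k j (z j)"
      by (rule module_power_eqI[OF Suc.prems(2) P.M.a_closed[OF y coord_inj_in_carrier[OF M zj]]])
        (auto simp: coord_inj_def z)
    have "P ?y"
      by (rule Suc.IH[OF _ y]) (use Suc.prems in auto)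
    moreover have "P (coord_inj M k j (z j))" using inj Suc.prems(1) zj by simp
    ultimately have "P (?y \<oplus>\<^bsub>module_power M k\<^esub> coord_inj M k j (z j))"
      by (intro add y coord_inj_in_carrier[OF M] zj)
    then show ?case using eq by simp
  qed
  from this[of k z] z show ?thesis by simp
qed

text \<open>
  This is the homomorphism on \<open>M^k\<close> with components \<open>f 0, \<dots>, f (k - 1)\<close>. The recursion turns statements about
  finite sums into inductions on the number of summands.
\<close>

primrec hom_sum :: "('a, 'c, 'n) module_scheme \<Rightarrow> (nat \<Rightarrow> 'b \<Rightarrow> 'c) \<Rightarrow> nat \<Rightarrow> (nat \<Rightarrow> 'b) \<Rightarrow> 'c" where
  "hom_sum N f 0 z = \<zero>\<^bsub>N\<^esub>"
| "hom_sum N f (Suc k) z = hom_sum N f k z \<oplus>\<^bsub>N\<^esub> f k (z k)"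

lemma hom_sum_hom:
  assumes M: "module R M" and N: "module R N" and f: "\<And>i. i < k \<Longrightarrow> f i \<in> module_hom R M N"
  shows "hom_sum N f k \<in> module_hom R (module_power M k) N"
proof -
  interpret N: Module.module R N by fact
  \<comment> \<open>The induction is over partial sums on the fixed module \<open>M^k\<close>, since elements of \<open>M^(j+1)\<close> are not in \<open>M^j\<close>.\<close>
  have "hom_sum N f j \<in> module_hom R (module_power M k) N" if "j \<le> k" for j
    using that
  proof (induction j)
    case 0
    show ?case by (rule homI) simp_all
  next
    case (Suc j)
    have "(\<lambda>z. f j (z j)) \<in> module_hom R (module_power M k) N"
      using Suc.prems by (intro hom_compose[OF component_hom f]) auto
    with Suc show ?case
      using hom_plus[OF N, of "hom_sum N f j"] by (simp add: hom_sum.simps(2)[abs_def])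
  qed
  then show ?thesis by simp
qed

lemma hom_sum_coord_inj:
  assumes M: "module R M" and N: "module R N" and f: "\<And>i. i < k \<Longrightarrow> f i \<in> module_hom R M N"
    and i: "i < k" and x: "x \<in> carrier M"
  shows "hom_sum N f k (coord_inj M k i x) = f i x"
proof -
  interpret N: Module.module R N by fact
  have "hom_sum N f j (coord_inj M k i x) = (if i < j then f i x else \<zero>\<^bsub>N\<^esub>)" if "j \<le> k" for j
    using that
  proof (induction j)
    case (Suc j)
    then have "f j \<zero>\<^bsub>M\<^esub> = \<zero>\<^bsub>N\<^esub>" using hom_zero[OF M N] f by simp
    with Suc show ?case
      using hom_in_carrier[OF f[OF i] x] by (auto simp: coord_inj_def less_Suc_eq)
  qed simp
  from this[of k] i show ?thesis by simp
qed

abbreviation free_module :: "('a, 'r) ring_scheme \<Rightarrow> nat \<Rightarrow> ('a, nat \<Rightarrow> 'a) module" where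
  "free_module R k \<equiv> module_power (regular_module R) k"

abbreviation unit_vector :: "('a, 'r) ring_scheme \<Rightarrow> nat \<Rightarrow> nat \<Rightarrow> nat \<Rightarrow> 'a" where
  "unit_vector R k i \<equiv> coord_inj (regular_module R) k i \<one>\<^bsub>R\<^esub>"

lemma regular_module_simps [simp]:
  "carrier (regular_module R) = carrier R" "\<zero>\<^bsub>regular_module R\<^esub> = \<zero>\<^bsub>R\<^esub>"
  "x \<oplus>\<^bsub>regular_module R\<^esub> y = x \<oplus>\<^bsub>R\<^esub> y" "r \<odot>\<^bsub>regular_module R\<^esub> x = r \<otimes>\<^bsub>R\<^esub> x"
  by (simp_all add: regular_module_def)

lemma regular_module_module:
  assumes "cring R"
  shows "module R (regular_module R)"
proof -
  interpret cring R by fact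
  show ?thesis
    by (rule module_criteria[OF assms])
      (auto simp: a_ac m_assoc l_distr r_distr intro: r_neg)
qed

lemma free_module_module: "cring R \<Longrightarrow> module R (free_module R k)"
  by (intro module_power_module regular_module_module)

lemma module_cring: "module R M \<Longrightarrow> cring R"
  by (rule Module.module.axioms(1))

lemma unit_vector_in_carrier: "cring R \<Longrightarrow> unit_vector R k i \<in> carrier (free_module R k)"
  by (rule coord_inj_in_carrier[OF regular_module_module])
    (simp_all add: cring.axioms(1) ring.is_monoid monoid.one_closed)

lemma coord_inj_eq_smult_unit_vector:
  assumes "cring R" "r \<in> carrier R"
  shows "coord_inj (regular_module R) k i r = r \<odot>\<^bsub>free_module R k\<^esub> unit_vector R k i"
proof -
  interpret cring R by fact
  have "r \<odot>\<^bsub>regular_module R\<^esub> \<one>\<^bsub>R\<^esub> = r" using assms(2) by simp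
  then show ?thesis
    using hom_smult[OF coord_inj_hom[OF regular_module_module[OF assms(1)]] assms(2)]
    by (metis one_closed regular_module_simps(1))
qed

lemma free_module_induct [consumes 2, case_names zero unit add smult]:
  assumes R: "cring R" and z: "z \<in> carrier (free_module R k)"
    and zero: "P \<zero>\<^bsub>free_module R k\<^esub>"
    and unit: "\<And>i. i < k \<Longrightarrow> P (unit_vector R k i)"
    and add: "\<And>x y. x \<in> carrier (free_module R k) \<Longrightarrow> y \<in> carrier (free_module R k)
        \<Longrightarrow> P x \<Longrightarrow> P y \<Longrightarrow> P (x \<oplus>\<^bsub>free_module R k\<^esub> y)"
    and smult: "\<And>r x. r \<in> carrier R \<Longrightarrow> x \<in> carrier (free_module R k)
        \<Longrightarrow> P x \<Longrightarrow> P (r \<odot>\<^bsub>free_module R k\<^esub> x)"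
  shows "P z"
  using regular_module_module[OF R] z
proof (induction rule: module_power_induct)
  case (inj i x)
  then show ?case
    using smult[OF _ unit_vector_in_carrier[OF R] unit[OF inj(1)]]
    by (simp add: coord_inj_eq_smult_unit_vector[OF R])
qed (fact zero, fact add)

lemma free_hom_eqI:
  assumes N: "module R N" and f: "f \<in> module_hom R (free_module R k) N"
    and g: "g \<in> module_hom R (free_module R k) N"
    and eq: "\<And>i. i < k \<Longrightarrow> f (unit_vector R k i) = g (unit_vector R k i)"
    and z: "z \<in> carrier (free_module R k)"
  shows "f z = g z"
proof -
  have R: "cring R" using N by (rule module_cring)
  note F = free_module_module[OF R, of k]
  from R z show ?thesis
    by (induction rule: free_module_induct)
      (simp_all add: hom_zero[OF F N f] hom_zero[OF F N g] eq hom_add[OF f] hom_add[OF g]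
        hom_smult[OF f] hom_smult[OF g])
qed

definition linear_comb :: "('a, 'c, 'n) module_scheme \<Rightarrow> nat \<Rightarrow> (nat \<Rightarrow> 'c) \<Rightarrow> (nat \<Rightarrow> 'a) \<Rightarrow> 'c" where
  "linear_comb N k x = hom_sum N (\<lambda>i r. r \<odot>\<^bsub>N\<^esub> x i) k"

lemma linear_comb_hom:
  assumes N: "module R N" and x: "\<And>i. i < k \<Longrightarrow> x i \<in> carrier N"
  shows "linear_comb N k x \<in> module_hom R (free_module R k) N"
    and "i < k \<Longrightarrow> linear_comb N k x (unit_vector R k i) = x i"
proof -
  interpret N: Module.module R N by fact
  note R = regular_module_module[OF N.R.is_cring]
  have hom: "(\<lambda>r. r \<odot>\<^bsub>N\<^esub> x i) \<in> module_hom R (regular_module R) N" if "i < k" for i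
    by (rule homI) (simp_all add: x[OF that] N.smult_l_distr N.smult_assoc1)
  show "linear_comb N k x \<in> module_hom R (free_module R k) N"
    unfolding linear_comb_def by (intro hom_sum_hom[OF R N] hom)
  show "linear_comb N k x (unit_vector R k i) = x i" if "i < k"
    unfolding linear_comb_def using hom_sum_coord_inj[OF R N hom that, where x="\<one>\<^bsub>R\<^esub>"] x[OF that]
    by simp
qed

text \<open>Free modules are projective: it suffices to lift the images of the unit vectors.\<close>

lemma free_hom_lift:
  assumes A: "module R A" and N: "module R N" and f: "f \<in> module_hom R A N"
    and g: "g \<in> module_hom R (free_module R p) N"
    and image: "g ` carrier (free_module R p) \<subseteq> f ` carrier A"
  obtains h where "h \<in> module_hom R (free_module R p) A"
    "\<And>s. s \<in> carrier (free_module R p) \<Longrightarrow> f (h s) = g s"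
proof -
  have R: "cring R" using N by (rule module_cring)
  have "\<exists>x. x \<in> carrier A \<and> f x = g (unit_vector R p i)" for i
    using subsetD[OF image imageI[OF unit_vector_in_carrier[OF R, of p i]]] by auto
  then obtain x where x: "\<And>i. x i \<in> carrier A" "\<And>i. f (x i) = g (unit_vector R p i)"
    by metis
  let ?h = "linear_comb A p x"
  have h: "?h \<in> module_hom R (free_module R p) A" by (rule linear_comb_hom[OF A x(1)])
  have "f (?h s) = g s" if "s \<in> carrier (free_module R p)" for s
    by (rule free_hom_eqI[OF N hom_compose[OF h f] g _ that]) (simp add: linear_comb_hom(2)[OF A x(1)] x(2))
  then show thesis using h that by blast
qed

section \<open>Finitely generated submodules\<close>

definition finitely_generated ::
    "('a, 'r) ring_scheme \<Rightarrow> ('a, 'c, 'n) module_scheme \<Rightarrow> 'c set \<Rightarrow> bool" where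
  "finitely_generated R N K \<longleftrightarrow>
     (\<exists>k. \<exists>f\<in>module_hom R (free_module R k) N. f ` carrier (free_module R k) = K)"

lemma finitely_generatedE:
  assumes "finitely_generated R N K"
  obtains k f where "f \<in> module_hom R (free_module R k) N" "f ` carrier (free_module R k) = K"
  using assms by (auto simp: finitely_generated_def)

lemma finitely_generated_submodule:
  assumes N: "module R N" and K: "finitely_generated R N K"
  shows "submodule R K N"
  using K by (rule finitely_generatedE)
    (use submodule_image[OF free_module_module[OF module_cring[OF N]] N] in blast)

lemma finitely_generated_image:
  assumes "f \<in> module_hom R A N" and "finitely_generated R A K"
  shows "finitely_generated R N (f ` K)"
proof -
  obtain k g where g: "g \<in> module_hom R (free_module R k) A" "g ` carrier (free_module R k) = K"
    using assms(2) by (rule finitely_generatedE)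
  have "(\<lambda>x. f (g x)) ` carrier (free_module R k) = f ` K"
    unfolding g(2)[symmetric] image_image ..
  then show ?thesis
    using hom_compose[OF g(1) assms(1)] unfolding finitely_generated_def by blast
qed

lemma finitely_generated_free: "finitely_generated R (free_module R k) (carrier (free_module R k))"
  unfolding finitely_generated_def by (intro exI[of _ k] bexI[OF _ hom_id]) simp

lemma finitely_generated_zero:
  assumes N: "module R N"
  shows "finitely_generated R N {\<zero>\<^bsub>N\<^esub>}"
proof -
  interpret N: Module.module R N by fact
  have "(\<lambda>x. \<zero>\<^bsub>N\<^esub>) \<in> module_hom R (free_module R 0) N" by (rule homI) simp_all
  from finitely_generated_image[OF this finitely_generated_free] show ?thesis
    by (simp add: carrier_module_power)
qed

text \<open>\<open>R^(p+m)\<close> is the direct sum of \<open>R^p\<close> and \<open>R^m\<close>.\<close>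

lemma free_module_split:
  assumes R: "cring R"
  obtains \<pi>\<^sub>1 \<pi>\<^sub>2 where "\<pi>\<^sub>1 \<in> module_hom R (free_module R (p + m)) (free_module R p)"
    "\<pi>\<^sub>2 \<in> module_hom R (free_module R (p + m)) (free_module R m)"
    "\<And>s t. s \<in> carrier (free_module R p) \<Longrightarrow> t \<in> carrier (free_module R m)
       \<Longrightarrow> \<exists>u\<in>carrier (free_module R (p + m)). \<pi>\<^sub>1 u = s \<and> \<pi>\<^sub>2 u = t"
proof
  note reg = regular_module_module[OF R]
  let ?\<pi>1 = "\<lambda>u. \<lambda>i\<in>{..<p}. u i" and ?\<pi>2 = "\<lambda>u. \<lambda>i\<in>{..<m}. u (p + i)"
  show "?\<pi>1 \<in> module_hom R (free_module R (p + m)) (free_module R p)"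
    by (intro hom_into_module_power reg component_hom) simp
  show "?\<pi>2 \<in> module_hom R (free_module R (p + m)) (free_module R m)"
    by (intro hom_into_module_power reg component_hom) simp
  fix s t assume s: "s \<in> carrier (free_module R p)" and t: "t \<in> carrier (free_module R m)"
  let ?u = "\<lambda>i\<in>{..<p + m}. if i < p then s i else t (i - p)"
  have u: "?u \<in> carrier (free_module R (p + m))"
    using module_power_component[OF s] module_power_component[OF t]
    by (intro restrict_in_module_power) auto
  moreover have "?\<pi>1 ?u = s" "?\<pi>2 ?u = t"
    using s t by (auto simp: carrier_module_power PiE_iff extensional_def restrict_def fun_eq_iff)
  ultimately show "\<exists>u\<in>carrier (free_module R (p + m)). ?\<pi>1 u = s \<and> ?\<pi>2 u = t" by blast
qed

lemma finitely_generated_sum: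
  assumes N: "module R N" and K: "finitely_generated R N K" and L: "finitely_generated R N L"
  shows "finitely_generated R N {x \<oplus>\<^bsub>N\<^esub> y | x y. x \<in> K \<and> y \<in> L}"
proof -
  obtain p f where f: "f \<in> module_hom R (free_module R p) N" "f ` carrier (free_module R p) = K"
    using K by (rule finitely_generatedE)
  obtain m g where g: "g \<in> module_hom R (free_module R m) N" "g ` carrier (free_module R m) = L"
    using L by (rule finitely_generatedE)
  obtain \<pi>\<^sub>1 \<pi>\<^sub>2 where \<pi>\<^sub>1: "\<pi>\<^sub>1 \<in> module_hom R (free_module R (p + m)) (free_module R p)"
    and \<pi>\<^sub>2: "\<pi>\<^sub>2 \<in> module_hom R (free_module R (p + m)) (free_module R m)"
    and surj: "\<And>s t. s \<in> carrier (free_module R p) \<Longrightarrow> t \<in> carrier (free_module R m)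
       \<Longrightarrow> \<exists>u\<in>carrier (free_module R (p + m)). \<pi>\<^sub>1 u = s \<and> \<pi>\<^sub>2 u = t"
    using free_module_split[OF module_cring[OF N]] by metis
  let ?h = "\<lambda>u. f (\<pi>\<^sub>1 u) \<oplus>\<^bsub>N\<^esub> g (\<pi>\<^sub>2 u)"
  have h: "?h \<in> module_hom R (free_module R (p + m)) N"
    by (intro hom_plus N hom_compose[OF \<pi>\<^sub>1 f(1)] hom_compose[OF \<pi>\<^sub>2 g(1)])
  have "?h ` carrier (free_module R (p + m)) = {x \<oplus>\<^bsub>N\<^esub> y | x y. x \<in> K \<and> y \<in> L}" (is "?A = ?B")
  proof (rule subset_antisym; rule subsetI)
    fix z assume "z \<in> ?A"
    then show "z \<in> ?B"
      using hom_in_carrier[OF \<pi>\<^sub>1] hom_in_carrier[OF \<pi>\<^sub>2] f(2) g(2) by blast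
  next
    fix z assume "z \<in> ?B"
    then obtain s t where "s \<in> carrier (free_module R p)" "t \<in> carrier (free_module R m)"
      "z = f s \<oplus>\<^bsub>N\<^esub> g t"
      using f(2) g(2) by blast
    then show "z \<in> ?A" using surj[of s t] by blast
  qed
  then show ?thesis using h unfolding finitely_generated_def by blast
qed

text \<open>\<open>M^(k+1)\<close> is the sum of a copy of \<open>M^k\<close> and a copy of \<open>M\<close>.\<close>

lemma finitely_generated_power:
  assumes M: "module R M" and fg: "finitely_generated R M (carrier M)"
  shows "finitely_generated R (module_power M k) (carrier (module_power M k))"
proof (induction k)
  case 0
  have "carrier (module_power M 0) = {\<zero>\<^bsub>module_power M 0\<^esub>}"
    by (simp add: module_power_def restrict_def)
  then show ?case
    using finitely_generated_zero[OF module_power_module[OF M]] by metis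
next
  case (Suc k)
  interpret M: Module.module R M by fact
  let ?P = "module_power M (Suc k)"
  interpret P: Module.module R ?P by (rule module_power_module[OF M])
  let ?e = "\<lambda>x. \<lambda>i\<in>{..<Suc k}. if i < k then x i else \<zero>\<^bsub>M\<^esub>"
  have "(\<lambda>x. if i < k then x i else \<zero>\<^bsub>M\<^esub>) \<in> module_hom R (module_power M k) M" for i
    by (rule homI) (simp_all add: module_power_component)
  from hom_into_module_power[OF M this]
  have e: "?e \<in> module_hom R (module_power M k) ?P" .
  let ?i = "coord_inj M (Suc k) k"
  have i: "?i \<in> module_hom R M ?P" by (rule coord_inj_hom[OF M])
  have "{x \<oplus>\<^bsub>?P\<^esub> y | x y. x \<in> ?e ` carrier (module_power M k) \<and> y \<in> ?i ` carrier M} = carrier ?P"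
    (is "?A = _")
  proof (rule subset_antisym; rule subsetI)
    fix z assume "z \<in> ?A"
    then show "z \<in> carrier ?P"
      using P.M.a_closed hom_in_carrier[OF e] hom_in_carrier[OF i] by blast
  next
    fix z assume z: "z \<in> carrier ?P"
    let ?x = "\<lambda>i\<in>{..<k}. z i"
    have x: "?x \<in> carrier (module_power M k)"
      using module_power_component[OF z] by (intro restrict_in_module_power) simp
    have zk: "z k \<in> carrier M" using module_power_component[OF z] by simp
    have "z = ?e ?x \<oplus>\<^bsub>?P\<^esub> ?i (z k)"
      by (rule module_power_eqI[OF z P.M.a_closed[OF hom_in_carrier[OF e x] hom_in_carrier[OF i zk]]])
        (auto simp: coord_inj_def module_power_component[OF z] less_Suc_eq zk)
    then show "z \<in> ?A" using x zk by blast
  qed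
  with finitely_generated_sum[OF module_power_module[OF M] finitely_generated_image[OF e Suc.IH]
      finitely_generated_image[OF i fg]]
  show ?case by simp
qed

section \<open>Coherent modules\<close>

text \<open>
  Homomorphisms from \<open>R^k\<close> correspond to families of \<open>k\<close> elements, and their kernels to the linear
  relations between these elements. So the modules below are those all of whose finitely generated
  submodules are finitely presented, Bourbaki's pseudo-coherent modules; the coherent modules in the
  stricter sense are the finitely generated ones among them.
\<close>

definition coherent_module ::
    "('a, 'r) ring_scheme \<Rightarrow> ('a, 'c, 'n) module_scheme \<Rightarrow> bool" where
  "coherent_module R N \<longleftrightarrow> module R N \<and> (\<forall>k. \<forall>f\<in>module_hom R (free_module R k) N.
     finitely_generated R (free_module R k) (hom_kernel (free_module R k) N f))"

lemma coherent_moduleD: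
  assumes "coherent_module R N"
  shows "module R N"
    and "f \<in> module_hom R (free_module R k) N
      \<Longrightarrow> finitely_generated R (free_module R k) (hom_kernel (free_module R k) N f)"
  using assms by (auto simp: coherent_module_def)

text \<open>
  Let \<open>p: R^n \<rightarrow> A\<close> be onto, and let \<open>g: R^m \<rightarrow> N\<close> have image \<open>K\<close>. Then \<open>a (p s) \<in> K\<close> if and only if some
  \<open>(s, t)\<close> is in the kernel of \<open>a \<circ> p - g\<close> on \<open>R^(n+m)\<close>. This kernel is finitely generated,
  and the inverse image of \<open>K\<close> is its image under \<open>(s, t) \<mapsto> p s\<close>.
\<close>

lemma finitely_generated_vimage:
  assumes A: "module R A" "finitely_generated R A (carrier A)" and N: "coherent_module R N"
    and a: "a \<in> module_hom R A N" and K: "finitely_generated R N K"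
  shows "finitely_generated R A {x \<in> carrier A. a x \<in> K}"
proof -
  note modN = coherent_moduleD(1)[OF N]
  interpret N: Module.module R N by (rule modN)
  obtain n p where p: "p \<in> module_hom R (free_module R n) A" "p ` carrier (free_module R n) = carrier A"
    using A(2) by (rule finitely_generatedE)
  obtain m g where g: "g \<in> module_hom R (free_module R m) N" "g ` carrier (free_module R m) = K"
    using K by (rule finitely_generatedE)
  obtain \<pi>\<^sub>1 \<pi>\<^sub>2 where \<pi>\<^sub>1: "\<pi>\<^sub>1 \<in> module_hom R (free_module R (n + m)) (free_module R n)"
    and \<pi>\<^sub>2: "\<pi>\<^sub>2 \<in> module_hom R (free_module R (n + m)) (free_module R m)"
    and surj: "\<And>s t. s \<in> carrier (free_module R n) \<Longrightarrow> t \<in> carrier (free_module R m)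
       \<Longrightarrow> \<exists>u\<in>carrier (free_module R (n + m)). \<pi>\<^sub>1 u = s \<and> \<pi>\<^sub>2 u = t"
    using free_module_split[OF N.R.is_cring] by metis
  let ?F = "free_module R (n + m)"
  let ?q = "\<lambda>u. p (\<pi>\<^sub>1 u)"
  have q: "?q \<in> module_hom R ?F A" by (rule hom_compose[OF \<pi>\<^sub>1 p(1)])
  let ?c = "\<lambda>u. a (?q u) \<ominus>\<^bsub>N\<^esub> g (\<pi>\<^sub>2 u)"
  have c: "?c \<in> module_hom R ?F N"
    by (intro hom_diff modN hom_compose[OF q a] hom_compose[OF \<pi>\<^sub>2 g(1)])
  have c0: "?c u = \<zero>\<^bsub>N\<^esub> \<longleftrightarrow> a (?q u) = g (\<pi>\<^sub>2 u)" if "u \<in> carrier ?F" for u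
    using that by (simp add: hom_in_carrier[OF a] hom_in_carrier[OF q] hom_in_carrier[OF g(1)]
        hom_in_carrier[OF \<pi>\<^sub>2])
  have "?q ` hom_kernel ?F N ?c = {x \<in> carrier A. a x \<in> K}" (is "?L = ?R")
  proof (rule subset_antisym; rule subsetI)
    fix x assume "x \<in> ?L"
    then obtain u where "u \<in> carrier ?F" "x = ?q u" "a x = g (\<pi>\<^sub>2 u)" using c0 by auto
    then show "x \<in> ?R" using hom_in_carrier[OF q] hom_in_carrier[OF \<pi>\<^sub>2] g(2) by auto
  next
    fix x assume "x \<in> ?R"
    then obtain s t where st: "s \<in> carrier (free_module R n)" "t \<in> carrier (free_module R m)"
      and x: "x = p s" "a x = g t"
      using p(2) g(2) by blast
    then obtain u where "u \<in> carrier ?F" "\<pi>\<^sub>1 u = s" "\<pi>\<^sub>2 u = t" using surj by blast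
    then show "x \<in> ?L" using x c0 by blast
  qed
  with finitely_generated_image[OF q coherent_moduleD(2)[OF N c]] show ?thesis by simp
qed

text \<open>
  The relations that hold after applying \<open>\<phi>\<close> are the combinations of finitely many of them, and those
  combinations that are also killed by \<open>\<psi>\<close> are given by relations in \<open>Q\<close>. Splitting off one
  coordinate at a time in this way shows that powers of coherent modules are coherent.
\<close>

lemma coherent_module_jointly_injective:
  assumes N: "module R N" and P: "coherent_module R P" and Q: "coherent_module R Q"
    and \<phi>: "\<phi> \<in> module_hom R N P" and \<psi>: "\<psi> \<in> module_hom R N Q"
    and inj: "\<And>x. x \<in> carrier N \<Longrightarrow> \<phi> x = \<zero>\<^bsub>P\<^esub> \<Longrightarrow> \<psi> x = \<zero>\<^bsub>Q\<^esub> \<Longrightarrow> x = \<zero>\<^bsub>N\<^esub>"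
  shows "coherent_module R N"
  unfolding coherent_module_def
proof (intro conjI allI ballI)
  fix k f assume f: "f \<in> module_hom R (free_module R k) N"
  let ?F = "free_module R k"
  obtain q g where g: "g \<in> module_hom R (free_module R q) ?F"
    and g_image: "g ` carrier (free_module R q) = hom_kernel ?F P (\<lambda>x. \<phi> (f x))"
    using coherent_moduleD(2)[OF P hom_compose[OF f \<phi>]] by (rule finitely_generatedE)
  let ?G = "free_module R q"
  have h: "(\<lambda>x. \<psi> (f (g x))) \<in> module_hom R ?G Q"
    by (rule hom_compose[OF g hom_compose[OF f \<psi>]])
  have iff: "f x = \<zero>\<^bsub>N\<^esub> \<longleftrightarrow> \<phi> (f x) = \<zero>\<^bsub>P\<^esub> \<and> \<psi> (f x) = \<zero>\<^bsub>Q\<^esub>" if "x \<in> carrier ?F" for x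
    using inj[OF hom_in_carrier[OF f that]] hom_zero[OF N coherent_moduleD(1)[OF P] \<phi>]
      hom_zero[OF N coherent_moduleD(1)[OF Q] \<psi>] by auto
  have "g ` hom_kernel ?G Q (\<lambda>x. \<psi> (f (g x))) = {x \<in> g ` carrier ?G. \<psi> (f x) = \<zero>\<^bsub>Q\<^esub>}"
    by blast
  also have "\<dots> = hom_kernel ?F N f"
    unfolding g_image using iff by blast
  finally show "finitely_generated R ?F (hom_kernel ?F N f)"
    using finitely_generated_image[OF g coherent_moduleD(2)[OF Q h]] by simp
qed (rule N)

lemma coherent_module_power:
  assumes N: "coherent_module R N"
  shows "coherent_module R (module_power N k)"
proof (induction k)
  case 0
  note mod = coherent_moduleD(1)[OF N]
  have zero: "(\<lambda>x. \<zero>\<^bsub>N\<^esub>) \<in> module_hom R (module_power N 0) N"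
  proof -
    interpret N: Module.module R N by (rule mod)
    show ?thesis by (rule homI) simp_all
  qed
  show ?case
    by (rule coherent_module_jointly_injective[OF module_power_module[OF mod] N N zero zero])
      (simp add: module_power_def restrict_def)
next
  case (Suc k)
  note mod = coherent_moduleD(1)[OF N]
  have "(\<lambda>x. \<lambda>i\<in>{..<k}. x i) \<in> module_hom R (module_power N (Suc k)) (module_power N k)"
    by (intro hom_into_module_power mod component_hom) simp
  moreover have "(\<lambda>x. x k) \<in> module_hom R (module_power N (Suc k)) N"
    by (rule component_hom) simp
  ultimately show ?case
  proof (rule coherent_module_jointly_injective[OF module_power_module[OF mod] Suc.IH N])
    interpret P: Module.module R "module_power N (Suc k)" by (rule module_power_module[OF mod])
    fix x assume x: "x \<in> carrier (module_power N (Suc k))"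
      and x0: "(\<lambda>i\<in>{..<k}. x i) = \<zero>\<^bsub>module_power N k\<^esub>" "x k = \<zero>\<^bsub>N\<^esub>"
    have "x i = \<zero>\<^bsub>N\<^esub>" if "i < k" for i
      using fun_cong[OF x0(1), of i] that by simp
    then show "x = \<zero>\<^bsub>module_power N (Suc k)\<^esub>"
      using x x0(2) by (intro module_power_eqI[of _ N "Suc k"]) (auto simp: less_Suc_eq)
  qed
qed

section \<open>Finitely presented modules over a coherent ring\<close>

lemma finitely_presented_iff:
  "finitely_presented R M \<longleftrightarrow> module R M \<and>
     (\<exists>n. \<exists>f\<in>module_hom R (free_module R n) M. f ` carrier (free_module R n) = carrier M \<and>
        finitely_generated R (free_module R n) (hom_kernel (free_module R n) M f))"
  unfolding finitely_presented_def finitely_generated_def by blast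

lemma finitely_presentedE:
  assumes "finitely_presented R M"
  obtains n f where "f \<in> module_hom R (free_module R n) M"
    "f ` carrier (free_module R n) = carrier M"
    "finitely_generated R (free_module R n) (hom_kernel (free_module R n) M f)"
  using assms unfolding finitely_presented_iff by blast

lemma finitely_presented_module: "finitely_presented R M \<Longrightarrow> module R M"
  by (simp add: finitely_presented_iff)

lemma finitely_presented_finitely_generated:
  "finitely_presented R M \<Longrightarrow> finitely_generated R M (carrier M)"
  unfolding finitely_presented_iff finitely_generated_def by blast

text \<open>
  A submodule of \<open>N\<close> is \<open>N\<close> with a smaller carrier, so homomorphisms into it are the homomorphisms
  into \<open>N\<close> with image in that carrier, with the same kernel.
\<close>

lemma hom_restrict_carrier:
  assumes "K \<subseteq> carrier N"
  shows "f \<in> module_hom R A (N\<lparr>carrier := K\<rparr>) \<longleftrightarrow>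
    f \<in> module_hom R A N \<and> f ` carrier A \<subseteq> K"
  using assms by (auto simp: LinearCombinations.module_hom_def)

lemma finitely_presented_restrict:
  assumes N: "coherent_module R N" and K: "finitely_generated R N K"
  shows "finitely_presented R (N\<lparr>carrier := K\<rparr>)"
proof -
  have sub: "submodule R K N"
    by (rule finitely_generated_submodule[OF coherent_moduleD(1)[OF N] K])
  obtain k f where f: "f \<in> module_hom R (free_module R k) N" "f ` carrier (free_module R k) = K"
    using K by (rule finitely_generatedE)
  then have "f \<in> module_hom R (free_module R k) (N\<lparr>carrier := K\<rparr>)"
    using sub by (subst hom_restrict_carrier) (auto simp: submodule_def)
  moreover have "hom_kernel (free_module R k) (N\<lparr>carrier := K\<rparr>) f = hom_kernel (free_module R k) N f"
    by simp
  ultimately show ?thesis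
    unfolding finitely_presented_iff
    using f(2) coherent_moduleD(2)[OF N f(1)] module_restrict_carrier[OF sub] by auto
qed

text \<open>
  Coherence of \<open>R\<close> provides one presentation of each finitely generated ideal, with generators of
  its own choice; this lemma transfers it to any given generators. Write the generators given by \<open>f\<close> and by \<open>g\<close> in terms of each other, \<open>f \<circ> a = g\<close> and
  \<open>g \<circ> b = f\<close>. A relation \<open>s\<close> of \<open>g\<close> is the sum of \<open>s - b (a s)\<close>, which is a relation for every
  \<open>s\<close>, and of the image under \<open>b\<close> of the relation \<open>a s\<close> of \<open>f\<close>.
\<close>

lemma finitely_generated_relations_independent:
  assumes N: "module R N"
    and f: "f \<in> module_hom R (free_module R n) N" and g: "g \<in> module_hom R (free_module R p) N"
    and image: "f ` carrier (free_module R n) = g ` carrier (free_module R p)"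
    and ker_f: "finitely_generated R (free_module R n) (hom_kernel (free_module R n) N f)"
  shows "finitely_generated R (free_module R p) (hom_kernel (free_module R p) N g)"
proof -
  let ?F = "free_module R n" and ?G = "free_module R p"
  have R: "cring R" using N by (rule module_cring)
  note F = free_module_module[OF R, of n] and G = free_module_module[OF R, of p]
  interpret N: Module.module R N by fact
  interpret G: Module.module R ?G by (rule G)
  obtain a where a: "a \<in> module_hom R ?G ?F" "\<And>s. s \<in> carrier ?G \<Longrightarrow> f (a s) = g s"
    using free_hom_lift[OF F N f g] image by blast
  obtain b where b: "b \<in> module_hom R ?F ?G" "\<And>t. t \<in> carrier ?F \<Longrightarrow> g (b t) = f t"
    using free_hom_lift[OF G N g f] image by blast
  let ?d = "\<lambda>s. s \<ominus>\<^bsub>?G\<^esub> b (a s)"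
  have d: "?d \<in> module_hom R ?G ?G"
    by (intro hom_diff G hom_id hom_compose[OF a(1) b(1)])
  note carr = hom_in_carrier[OF a(1)] hom_in_carrier[OF b(1)] hom_in_carrier[OF g]
    hom_in_carrier[OF f]
  have gd: "g (?d s) = \<zero>\<^bsub>N\<^esub>" if "s \<in> carrier ?G" for s
    using that by (simp add: hom_minus[OF G N g] carr b(2) a(2))
  have "{x \<oplus>\<^bsub>?G\<^esub> y | x y. x \<in> ?d ` carrier ?G \<and> y \<in> b ` hom_kernel ?F N f} = hom_kernel ?G N g"
    (is "?A = ?B")
  proof (rule subset_antisym; rule subsetI)
    fix z assume "z \<in> ?A"
    then obtain s t where "s \<in> carrier ?G" "t \<in> carrier ?F" "f t = \<zero>\<^bsub>N\<^esub>" "z = ?d s \<oplus>\<^bsub>?G\<^esub> b t"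
      by blast
    then show "z \<in> ?B"
      using gd by (simp add: hom_add[OF g] carr b(2))
  next
    fix s assume "s \<in> ?B"
    then have s: "s \<in> carrier ?G" "g s = \<zero>\<^bsub>N\<^esub>" by auto
    have "s = ?d s \<oplus>\<^bsub>?G\<^esub> b (a s)"
      using s(1) carr by (simp add: a_minus_def G.M.a_assoc G.M.l_neg)
    moreover have "a s \<in> hom_kernel ?F N f" using s carr a(2) by simp
    ultimately show "s \<in> ?A" using s(1) by blast
  qed
  with finitely_generated_sum[OF G finitely_generated_image[OF d finitely_generated_free]
      finitely_generated_image[OF b(1) ker_f]]
  show ?thesis by simp
qed

lemma submodule_regular_module_ideal:
  assumes "submodule R K (regular_module R)"
  shows "ideal K R"
proof -
  interpret K: submodule R K "regular_module R" by fact
  interpret cring R using K.module by (rule module_cring)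
  have "subgroup K (add_monoid R)"
  proof (rule subgroup.intro)
    fix x assume x: "x \<in> K"
    then have "x \<in> carrier R" using K.subset by auto
    then have "(\<ominus>\<^bsub>R\<^esub> \<one>\<^bsub>R\<^esub>) \<otimes>\<^bsub>R\<^esub> x = \<ominus>\<^bsub>R\<^esub> x" by (simp add: l_minus)
    moreover have "(\<ominus>\<^bsub>R\<^esub> \<one>\<^bsub>R\<^esub>) \<otimes>\<^bsub>R\<^esub> x \<in> K"
      using K.smult_closed[of "\<ominus>\<^bsub>R\<^esub> \<one>\<^bsub>R\<^esub>" x] x by simp
    ultimately show "inv\<^bsub>add_monoid R\<^esub> x \<in> K" by (simp add: a_inv_def)
  qed (use K.subset K.m_closed K.zero_closed in simp_all)
  moreover have "x \<otimes>\<^bsub>R\<^esub> a \<in> K" if "a \<in> K" "x \<in> carrier R" for a x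
    using K.smult_closed[OF that(2,1)] by simp
  moreover from this have "a \<otimes>\<^bsub>R\<^esub> x \<in> K" if "a \<in> K" "x \<in> carrier R" for a x
    using that K.subset m_comm[of a x] by auto
  ultimately show ?thesis by (intro idealI) (auto simp: ring_axioms)
qed

lemma hom_image_regular_module:
  assumes R: "cring R" and f: "f \<in> module_hom R (free_module R k) (regular_module R)"
  shows "f ` carrier (free_module R k) = Idl\<^bsub>R\<^esub> ((\<lambda>i. f (unit_vector R k i)) ` {..<k})"
    (is "?I = Idl\<^bsub>R\<^esub> ?S")
proof
  interpret cring R by fact
  note F = free_module_module[OF R, of k] and reg = regular_module_module[OF R]
  have S: "?S \<subseteq> carrier R"
    using hom_in_carrier[OF f unit_vector_in_carrier[OF R]] by auto
  interpret I: ideal "Idl\<^bsub>R\<^esub> ?S" R by (rule genideal_ideal[OF S])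
  have "f z \<in> Idl\<^bsub>R\<^esub> ?S" if "z \<in> carrier (free_module R k)" for z
    using R that
    by (induction rule: free_module_induct)
      (use genideal_self[OF S] in \<open>auto simp: hom_zero[OF F reg f] hom_add[OF f] hom_smult[OF f]
        I.I_l_closed\<close>)
  then show "?I \<subseteq> Idl\<^bsub>R\<^esub> ?S" by blast
  show "Idl\<^bsub>R\<^esub> ?S \<subseteq> ?I"
    by (rule genideal_minimal[OF submodule_regular_module_ideal[OF submodule_image[OF F reg f]]])
      (use unit_vector_in_carrier[OF R] in blast)
qed

lemma coherent_ring_coherent_module:
  assumes "coherent_ring R"
  shows "coherent_module R (regular_module R)"
  unfolding coherent_module_def
proof (intro conjI allI ballI)
  have R: "cring R" using assms by (simp add: coherent_ring_def)
  show reg: "module R (regular_module R)" by (rule regular_module_module[OF R])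
  fix k f assume f: "f \<in> module_hom R (free_module R k) (regular_module R)"
  let ?S = "(\<lambda>i. f (unit_vector R k i)) ` {..<k}"
  let ?I = "Idl\<^bsub>R\<^esub> ?S"
  have "?S \<subseteq> carrier R"
    using hom_in_carrier[OF f unit_vector_in_carrier[OF R]] by auto
  then have "finitely_presented R ((regular_module R)\<lparr>carrier := ?I\<rparr>)"
    using assms by (auto simp: coherent_ring_def)
  then obtain n g where g: "g \<in> module_hom R (free_module R n) ((regular_module R)\<lparr>carrier := ?I\<rparr>)"
    "g ` carrier (free_module R n) = ?I"
    "finitely_generated R (free_module R n) (hom_kernel (free_module R n) (regular_module R) g)"
    by (rule finitely_presentedE) simp
  note I = hom_image_regular_module[OF R f]
  have "?I \<subseteq> carrier (regular_module R)"
    unfolding I[symmetric] using hom_in_carrier[OF f] by blast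
  with g(1) have "g \<in> module_hom R (free_module R n) (regular_module R)"
    by (simp add: hom_restrict_carrier)
  then show "finitely_generated R (free_module R k) (hom_kernel (free_module R k) (regular_module R) f)"
    by (rule finitely_generated_relations_independent[OF reg _ f _ g(3)]) (simp add: g(2) I)
qed

text \<open>
  Let \<open>f: R^n \<rightarrow> N\<close> be a presentation. A homomorphism \<open>y: R^p \<rightarrow> N\<close> lifts to \<open>a: R^p \<rightarrow> R^n\<close>, and the
  kernel of \<open>y\<close> is the inverse image under \<open>a\<close> of the finitely generated kernel of \<open>f\<close>.
\<close>

lemma finitely_presented_coherent_module:
  assumes R: "coherent_ring R" and N: "finitely_presented R N"
  shows "coherent_module R N"
  unfolding coherent_module_def
proof (intro conjI allI ballI)
  show modN: "module R N" using N by (rule finitely_presented_module)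
  obtain n f where f: "f \<in> module_hom R (free_module R n) N"
    "f ` carrier (free_module R n) = carrier N"
    "finitely_generated R (free_module R n) (hom_kernel (free_module R n) N f)"
    using N by (rule finitely_presentedE)
  fix p y assume y: "y \<in> module_hom R (free_module R p) N"
  let ?F = "free_module R n" and ?G = "free_module R p"
  have cR: "cring R" using modN by (rule module_cring)
  have F: "coherent_module R ?F"
    by (rule coherent_module_power[OF coherent_ring_coherent_module[OF R]])
  obtain a where a: "a \<in> module_hom R ?G ?F" "\<And>s. s \<in> carrier ?G \<Longrightarrow> f (a s) = y s"
    using free_hom_lift[OF coherent_moduleD(1)[OF F] modN f(1) y] hom_in_carrier[OF y] f(2) by blast
  have "hom_kernel ?G N y = {s \<in> carrier ?G. a s \<in> hom_kernel ?F N f}"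
    using a(2) hom_in_carrier[OF a(1)] by auto
  then show "finitely_generated R ?G (hom_kernel ?G N y)"
    using finitely_generated_vimage[OF free_module_module[OF cR] finitely_generated_free F a(1) f(3)]
    by simp
qed

lemma finitely_presented_quotient:
  assumes R: "coherent_ring R" and N: "finitely_presented R N" and K: "finitely_generated R N K"
  shows "finitely_presented R (quotient_module N K)"
proof -
  note modN = finitely_presented_module[OF N]
  have sub: "submodule R K N" by (rule finitely_generated_submodule[OF modN K])
  obtain n f where f: "f \<in> module_hom R (free_module R n) N"
    "f ` carrier (free_module R n) = carrier N"
    using finitely_presented_finitely_generated[OF N] by (rule finitely_generatedE)
  let ?F = "free_module R n" and ?\<pi> = "\<lambda>x. K +>\<^bsub>N\<^esub> f x"
  have \<pi>: "?\<pi> \<in> module_hom R ?F (quotient_module N K)"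
    by (rule hom_compose[OF f(1) quotient_projection[OF sub]])
  have surj: "?\<pi> ` carrier ?F = carrier (quotient_module N K)"
    unfolding carrier_quotient_module f(2)[symmetric] image_image ..
  have "hom_kernel ?F (quotient_module N K) ?\<pi> = {x \<in> carrier ?F. f x \<in> K}"
    using coset_eq_zero_iff[OF sub hom_in_carrier[OF f(1)]] by auto
  then have "finitely_generated R ?F (hom_kernel ?F (quotient_module N K) ?\<pi>)"
    using finitely_generated_vimage[OF free_module_module[OF module_cring[OF modN]]
        finitely_generated_free finitely_presented_coherent_module[OF R N] f(1) K] by simp
  then show ?thesis
    unfolding finitely_presented_iff using quotient_module_module[OF sub] \<pi> surj by blast
qed

section \<open>The trace of a finitely presented module\<close>

context
  fixes R :: "('a, 'r) ring_scheme" and M :: "('a, 'b, 'm) module_scheme"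
    and N :: "('a, 'c, 'n) module_scheme"
  assumes M: "module R M" and N: "module R N"
begin

interpretation N: Module.module R N by (rule N)

lemma hom_images_subset: "(\<Union>f\<in>module_hom R M N. f ` carrier M) \<subseteq> carrier N"
  by (auto simp: hom_in_carrier)

lemma trace_submodule_is_submodule: "submodule R (trace_submodule R M N) N"
  unfolding trace_submodule_def by (rule N.span_is_submodule[OF hom_images_subset])

lemma hom_in_trace_submodule:
  assumes "f \<in> module_hom R M N" "x \<in> carrier M"
  shows "f x \<in> trace_submodule R M N"
  unfolding trace_submodule_def using N.in_own_span[OF hom_images_subset] assms by blast

lemma trace_submodule_subset:
  assumes "submodule R K N" "\<And>f x. f \<in> module_hom R M N \<Longrightarrow> x \<in> carrier M \<Longrightarrow> f x \<in> K"
  shows "trace_submodule R M N \<subseteq> K"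
  unfolding trace_submodule_def by (rule N.span_is_subset[OF _ assms(1)]) (use assms(2) in auto)

lemma power_hom_in_trace_submodule:
  assumes f: "f \<in> module_hom R (module_power M k) N" and z: "z \<in> carrier (module_power M k)"
  shows "f z \<in> trace_submodule R M N"
proof -
  interpret T: submodule R "trace_submodule R M N" N by (rule trace_submodule_is_submodule)
  from M z show ?thesis
  proof (induction rule: module_power_induct)
    case zero
    show ?case using hom_zero[OF module_power_module[OF M] N f] by simp
  next
    case (inj i x)
    then show ?case by (intro hom_in_trace_submodule[OF hom_compose[OF coord_inj_hom[OF M] f]])
  next
    case (add x y)
    then show ?case by (simp add: hom_add[OF f])
  qed
qed

end

text \<open>
  The pairing \<open>(y, r) \<mapsto> \<Sum> r\<^sub>i y\<^sub>i\<close> is linear in the vector \<open>y\<close> too, because \<open>R\<close> is commutative. For a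
  relation \<open>r\<close> between generators of \<open>M\<close>, this is the condition that a homomorphism on \<open>M\<close> imposes on
  the images \<open>y\<close> of the generators.
\<close>

lemma linear_comb_hom_left:
  assumes N: "module R N" and r: "r \<in> carrier (free_module R n)"
  shows "(\<lambda>y. linear_comb N n y r) \<in> module_hom R (module_power N n) N"
proof -
  interpret N: Module.module R N by fact
  have "(\<lambda>y. hom_sum N (\<lambda>i s. s \<odot>\<^bsub>N\<^esub> y i) j r) \<in> module_hom R (module_power N n) N" if "j \<le> n" for j
    using that
  proof (induction j)
    case 0
    show ?case by (rule homI) simp_all
  next
    case (Suc j)
    have rj: "r j \<in> carrier R" using module_power_component[OF r] Suc.prems by simp
    have "(\<lambda>y. r j \<odot>\<^bsub>N\<^esub> y j) \<in> module_hom R (module_power N n) N"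
      using Suc.prems by (intro hom_smult_left[OF N component_hom rj]) simp
    from hom_plus[OF N Suc.IH this] Suc.prems show ?case by simp
  qed
  then show ?thesis by (simp add: linear_comb_def)
qed

text \<open>
  Choose a presentation \<open>R^m \<rightarrow> R^n \<rightarrow> M \<rightarrow> 0\<close>. A homomorphism from \<open>M\<close> to \<open>N\<close> is a vector of
  \<open>N^n\<close>, the images of the generators, that is killed by the relations, so \<open>Hom(M, N)\<close> is the
  kernel of a homomorphism from \<open>N^n\<close> to \<open>N^m\<close>. As \<open>N^n\<close> is finitely generated and \<open>N^m\<close> is
  coherent, this kernel is finitely generated. If \<open>f\<^sub>1, \<dots>, f\<^sub>k\<close> generate it, then
  \<open>(\<Sum> s\<^sub>i f\<^sub>i)(x) = \<Sum> f\<^sub>i(s\<^sub>i x)\<close>, so that \<open>f\<^sub>1(M) + \<dots> + f\<^sub>k(M)\<close> contains the image of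
  every homomorphism.
\<close>

lemma trace_submodule_power_image:
  assumes M: "finitely_presented R M" and N: "coherent_module R N" "finitely_generated R N (carrier N)"
  obtains k \<Phi> where "\<Phi> \<in> module_hom R (module_power M k) N"
    "\<Phi> ` carrier (module_power M k) = trace_submodule R M N"
proof -
  note modM = finitely_presented_module[OF M] and modN = coherent_moduleD(1)[OF N(1)]
  interpret M: Module.module R M by (rule modM)
  interpret N: Module.module R N by (rule modN)
  have R: "cring R" by (rule M.R.is_cring)
  obtain n p where p: "p \<in> module_hom R (free_module R n) M"
    "p ` carrier (free_module R n) = carrier M"
    "finitely_generated R (free_module R n) (hom_kernel (free_module R n) M p)"
    using M by (rule finitely_presentedE)
  let ?F = "free_module R n"
  obtain m g where g: "g \<in> module_hom R (free_module R m) ?F"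
    "g ` carrier (free_module R m) = hom_kernel ?F M p"
    using p(3) by (rule finitely_generatedE)
  let ?G = "free_module R m"
  note F = free_module_module[OF R, of n] and G = free_module_module[OF R, of m]
  let ?A = "module_power N n" and ?B = "module_power N m"
  note A = module_power_module[OF modN, of n] and B = module_power_module[OF modN, of m]
  define rel where "rel j = g (unit_vector R m j)" for j
  have rel: "rel j \<in> carrier ?F" for j
    unfolding rel_def by (rule hom_in_carrier[OF g(1) unit_vector_in_carrier[OF R]])
  let ?\<Psi> = "\<lambda>y. \<lambda>j\<in>{..<m}. linear_comb N n y (rel j)"
  have \<Psi>: "?\<Psi> \<in> module_hom R ?A ?B"
    by (intro hom_into_module_power modN linear_comb_hom_left rel)
  have "finitely_generated R ?A {y \<in> carrier ?A. ?\<Psi> y \<in> {\<zero>\<^bsub>?B\<^esub>}}"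
    by (rule finitely_generated_vimage[OF A finitely_generated_power[OF modN N(2)]
          coherent_module_power[OF N(1)] \<Psi> finitely_generated_zero[OF B]])
  then obtain k u where u: "u \<in> module_hom R (free_module R k) ?A"
    and u_image: "u ` carrier (free_module R k) = {y \<in> carrier ?A. ?\<Psi> y \<in> {\<zero>\<^bsub>?B\<^esub>}}"
    by (rule finitely_generatedE)
  have lin: "linear_comb N n y \<in> module_hom R ?F N" if "y \<in> carrier ?A" for y
    by (rule linear_comb_hom(1)[OF modN]) (rule module_power_component[OF that])
  \<comment> \<open>Each generator of the kernel of \<open>\<Psi>\<close> kills the relations of \<open>M\<close>, so it defines a homomorphism on \<open>M\<close>.\<close>
  have "\<exists>f\<in>module_hom R M N. \<forall>r\<in>carrier ?F. f (p r) = linear_comb N n (u (unit_vector R k i)) r" for i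
  proof -
    let ?y = "u (unit_vector R k i)"
    have "?y \<in> u ` carrier (free_module R k)" using unit_vector_in_carrier[OF R] by blast
    then have y: "?y \<in> carrier ?A" and y0: "?\<Psi> ?y = \<zero>\<^bsub>?B\<^esub>" unfolding u_image by auto
    have vanish: "linear_comb N n ?y (g t) = \<zero>\<^bsub>N\<^esub>" if t: "t \<in> carrier ?G" for t
    proof (rule free_hom_eqI[OF modN hom_compose[OF g(1) lin[OF y]] _ _ t])
      show "(\<lambda>t. \<zero>\<^bsub>N\<^esub>) \<in> module_hom R ?G N" by (rule homI) simp_all
      show "linear_comb N n ?y (g (unit_vector R m j)) = \<zero>\<^bsub>N\<^esub>" if "j < m" for j
        using fun_cong[OF y0, of j] that by (simp add: rel_def)
    qed
    have "linear_comb N n ?y r = \<zero>\<^bsub>N\<^esub>" if "r \<in> carrier ?F" "p r = \<zero>\<^bsub>M\<^esub>" for r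
    proof -
      have "r \<in> g ` carrier ?G" unfolding g(2) using that by simp
      then show ?thesis using vanish by blast
    qed
    from factor_through_surjection[OF F modM modN p(1,2) lin[OF y] this] show ?thesis by metis
  qed
  then obtain f where f: "\<And>i. f i \<in> module_hom R M N"
    and fp: "\<And>i r. r \<in> carrier ?F \<Longrightarrow> f i (p r) = linear_comb N n (u (unit_vector R k i)) r"
    by metis
  let ?\<Phi> = "hom_sum N f k"
  have \<Phi>: "?\<Phi> \<in> module_hom R (module_power M k) N" by (rule hom_sum_hom[OF modM modN f])
  have "?\<Phi> ` carrier (module_power M k) = trace_submodule R M N"
  proof
    show "?\<Phi> ` carrier (module_power M k) \<subseteq> trace_submodule R M N"
      using power_hom_in_trace_submodule[OF modM modN \<Phi>] by blast
    show "trace_submodule R M N \<subseteq> ?\<Phi> ` carrier (module_power M k)"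
    proof (rule trace_submodule_subset[OF modM modN submodule_image[OF module_power_module[OF modM] modN \<Phi>]])
      fix h x assume h: "h \<in> module_hom R M N" and x: "x \<in> carrier M"
      obtain r where r: "r \<in> carrier ?F" "x = p r" using x p(2) by blast
      \<comment> \<open>The vector of images of the generators lies in the kernel of \<open>\<Psi>\<close> and determines \<open>h\<close>.\<close>
      let ?y = "\<lambda>i\<in>{..<n}. h (p (unit_vector R n i))"
      have y: "?y \<in> carrier ?A"
        by (intro restrict_in_module_power hom_in_carrier[OF h] hom_in_carrier[OF p(1)]
            unit_vector_in_carrier[OF R])
      have hp: "linear_comb N n ?y r = h (p r)" if "r \<in> carrier ?F" for r
      proof (rule free_hom_eqI[OF modN lin[OF y] hom_compose[OF p(1) h] _ that])
        fix i assume "i < n"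
        then show "linear_comb N n ?y (unit_vector R n i) = h (p (unit_vector R n i))"
          by (subst linear_comb_hom(2)[OF modN]) (use module_power_component[OF y] in auto)
      qed
      have "linear_comb N n ?y (rel j) = \<zero>\<^bsub>N\<^esub>" for j
      proof -
        have "rel j \<in> hom_kernel ?F M p"
          unfolding g(2)[symmetric] rel_def using unit_vector_in_carrier[OF R] by blast
        then show ?thesis using hp[OF rel] hom_zero[OF modM modN h] by simp
      qed
      then have "?\<Psi> ?y = \<zero>\<^bsub>?B\<^esub>"
        by (intro module_power_eqI[OF hom_in_carrier[OF \<Psi> y]])
          (simp_all add: Module.module.axioms(2)[OF B] abelian_group.axioms(1) abelian_monoid.zero_closed)
      with y have "?y \<in> u ` carrier (free_module R k)" unfolding u_image by simp
      then obtain s where s: "s \<in> carrier (free_module R k)" "?y = u s" by blast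
      \<comment> \<open>Both sides of the equation for \<open>u s\<close> below are linear in \<open>s\<close>, so it can be checked on unit vectors.\<close>
      let ?z = "\<lambda>s. \<lambda>i\<in>{..<k}. s i \<odot>\<^bsub>M\<^esub> p r"
      have pr: "p r \<in> carrier M" by (rule hom_in_carrier[OF p(1) r(1)])
      have "(\<lambda>c. c \<odot>\<^bsub>M\<^esub> p r) \<in> module_hom R (regular_module R) M"
        by (rule homI) (simp_all add: pr M.smult_l_distr M.smult_assoc1)
      then have z: "?z \<in> module_hom R (free_module R k) (module_power M k)"
        by (intro hom_into_module_power modM hom_compose[OF component_hom])
      have "linear_comb N n (u s) r = ?\<Phi> (?z s)"
      proof (rule free_hom_eqI[OF modN hom_compose[OF u linear_comb_hom_left[OF modN r(1)]]
            hom_compose[OF z \<Phi>] _ s(1)])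
        fix i assume i: "i < k"
        have "?z (unit_vector R k i) = coord_inj M k i (p r)"
          using pr by (auto simp: coord_inj_def intro!: restrict_ext)
        then show "linear_comb N n (u (unit_vector R k i)) r = ?\<Phi> (?z (unit_vector R k i))"
          by (simp add: hom_sum_coord_inj[OF modM modN f i pr] fp[OF r(1)])
      qed
      then have "h x = ?\<Phi> (?z s)" using hp[OF r(1)] s(2) r(2) by simp
      then show "h x \<in> ?\<Phi> ` carrier (module_power M k)"
        using hom_in_carrier[OF z s(1)] by blast
    qed
  qed
  with \<Phi> show thesis by (rule that)
qed

lemma trace_submodule_finitely_generated:
  assumes M: "finitely_presented R M" and N: "coherent_module R N" "finitely_generated R N (carrier N)"
  shows "finitely_generated R N (trace_submodule R M N)"
proof -
  obtain k \<Phi> where \<Phi>: "\<Phi> \<in> module_hom R (module_power M k) N"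
    "\<Phi> ` carrier (module_power M k) = trace_submodule R M N"
    using M N by (rule trace_submodule_power_image)
  have "finitely_generated R (module_power M k) (carrier (module_power M k))"
    using M by (intro finitely_generated_power finitely_presented_module
        finitely_presented_finitely_generated)
  from finitely_generated_image[OF \<Phi>(1) this] show ?thesis by (simp add: \<Phi>(2))
qed

section \<open>The trace filtration\<close>

text \<open>
  This is an equality of records, because cosets do not depend on the carrier. Facts about submodules of
  \<open>N/K\<close> therefore apply to \<open>L/K\<close> without passing through an isomorphism.
\<close>

lemma quotient_module_restrict:
  "quotient_module (N\<lparr>carrier := L\<rparr>) K = (quotient_module N K)\<lparr>carrier := (\<lambda>x. K +>\<^bsub>N\<^esub> x) ` L\<rparr>"
proof -
  have "K +>\<^bsub>N\<lparr>carrier := L\<rparr>\<^esub> x = K +>\<^bsub>N\<^esub> x" for x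
    by (simp add: a_r_coset_def')
  then show ?thesis
    by (auto simp: quotient_module_def A_RCOSETS_def' set_add_def'[abs_def])
qed

context
  fixes R :: "('a, 'r) ring_scheme" and M :: "('a, 'b, 'm) module_scheme"
    and N :: "('a, 'c, 'n) module_scheme"
  assumes R: "coherent_ring R" and M: "finitely_presented R M" and N: "finitely_presented R N"
begin

lemma trace_filtration_finitely_generated: "finitely_generated R N (trace_filtration R M N i)"
proof (induction i)
  case 0
  show ?case using finitely_generated_zero[OF finitely_presented_module[OF N]] by simp
next
  case (Suc i)
  let ?K = "trace_filtration R M N i"
  let ?Q = "quotient_module N ?K"
  note Q = finitely_presented_quotient[OF R N Suc]
  note sub = finitely_generated_submodule[OF finitely_presented_module[OF N] Suc]
  have "finitely_generated R ?Q (trace_submodule R M ?Q)"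
    by (rule trace_submodule_finitely_generated[OF M finitely_presented_coherent_module[OF R Q]
          finitely_presented_finitely_generated[OF Q]])
  from finitely_generated_vimage[OF finitely_presented_module[OF N]
      finitely_presented_finitely_generated[OF N] finitely_presented_coherent_module[OF R Q]
      quotient_projection[OF sub] this]
  show ?case by simp
qed

lemma trace_filtration_submodule: "submodule R (trace_filtration R M N i) N"
  by (rule finitely_generated_submodule[OF finitely_presented_module[OF N]
        trace_filtration_finitely_generated])

lemma trace_filtration_finitely_presented:
  "finitely_presented R (N\<lparr>carrier := trace_filtration R M N i\<rparr>)"
  by (rule finitely_presented_restrict[OF finitely_presented_coherent_module[OF R N]
        trace_filtration_finitely_generated])

lemma trace_factor_finitely_presented: "finitely_presented R (quotient_module N (trace_filtration R M N i))"
  by (rule finitely_presented_quotient[OF R N trace_filtration_finitely_generated])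

lemma trace_factor_submodule:
  "submodule R (trace_submodule R M (quotient_module N (trace_filtration R M N i)))
     (quotient_module N (trace_filtration R M N i))"
  by (rule trace_submodule_is_submodule[OF finitely_presented_module[OF M]
        finitely_presented_module[OF trace_factor_finitely_presented]])

lemma trace_filtration_Suc_mono: "trace_filtration R M N i \<subseteq> trace_filtration R M N (Suc i)"
proof
  fix x assume x: "x \<in> trace_filtration R M N i"
  then have xN: "x \<in> carrier N" by (rule submodule_in_carrier[OF trace_filtration_submodule])
  have "\<zero>\<^bsub>quotient_module N (trace_filtration R M N i)\<^esub>
      \<in> trace_submodule R M (quotient_module N (trace_filtration R M N i))"
    by (rule submodule.zero_closed[OF trace_factor_submodule])
  then show "x \<in> trace_filtration R M N (Suc i)"
    using xN coset_eq_zero_iff[OF trace_filtration_submodule xN, THEN iffD2, OF x] by simp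
qed

lemma trace_filtration_mono: "i \<le> j \<Longrightarrow> trace_filtration R M N i \<subseteq> trace_filtration R M N j"
  by (rule lift_Suc_mono_le[of "trace_filtration R M N", OF trace_filtration_Suc_mono])

lemma trace_filtration_factor:
  "quotient_module (N\<lparr>carrier := trace_filtration R M N (Suc i)\<rparr>) (trace_filtration R M N i) =
     (quotient_module N (trace_filtration R M N i))\<lparr>carrier :=
       trace_submodule R M (quotient_module N (trace_filtration R M N i))\<rparr>"
proof -
  let ?K = "trace_filtration R M N i"
  let ?T = "trace_submodule R M (quotient_module N ?K)"
  have "?T \<subseteq> (\<lambda>x. ?K +>\<^bsub>N\<^esub> x) ` carrier N"
    using submodule_in_carrier[OF trace_factor_submodule] unfolding carrier_quotient_module by blast
  then have "(\<lambda>x. ?K +>\<^bsub>N\<^esub> x) ` trace_filtration R M N (Suc i) = ?T" by auto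
  then show ?thesis by (simp only: quotient_module_restrict)
qed

lemma trace_filtration_factor_gen:
  "gen R M (quotient_module (N\<lparr>carrier := trace_filtration R M N (Suc i)\<rparr>) (trace_filtration R M N i))"
proof -
  let ?Q = "quotient_module N (trace_filtration R M N i)"
  let ?T = "trace_submodule R M ?Q"
  note Q = finitely_presented_coherent_module[OF R trace_factor_finitely_presented]
    finitely_presented_finitely_generated[OF trace_factor_finitely_presented]
  have "finitely_presented R (?Q\<lparr>carrier := ?T\<rparr>)"
    by (rule finitely_presented_restrict[OF Q(1) trace_submodule_finitely_generated[OF M Q]])
  moreover obtain k \<Phi> where \<Phi>: "\<Phi> \<in> module_hom R (module_power M k) ?Q"
    "\<Phi> ` carrier (module_power M k) = ?T"
    using M Q by (rule trace_submodule_power_image)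
  moreover have "?T \<subseteq> carrier ?Q"
    using submodule_in_carrier[OF trace_factor_submodule] by blast
  ultimately show ?thesis
    unfolding trace_filtration_factor gen_def
    by (intro conjI exI[of _ k] bexI[of _ \<Phi>]) (simp_all add: hom_restrict_carrier)
qed

text \<open>
  The trace filtration grows at least as fast as any other filtration with factors generated by \<open>M\<close>:
  the homomorphisms from powers of \<open>M\<close> onto the next factor can be followed by the homomorphism
  induced by the inclusion, into the quotient by the larger submodule.
\<close>

lemma gen_filtration_step_subset:
  assumes L: "submodule R L N" and K: "submodule R K N" and KL: "K \<subseteq> L"
    and gen: "gen R M (quotient_module (N\<lparr>carrier := L\<rparr>) K)"
    and KT: "K \<subseteq> trace_filtration R M N i"
  shows "L \<subseteq> trace_filtration R M N (Suc i)"
proof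
  let ?L = "N\<lparr>carrier := L\<rparr>" and ?T = "trace_filtration R M N i"
  let ?Q = "quotient_module ?L K" and ?P = "quotient_module N ?T"
  have modL: "module R ?L" by (rule module_restrict_carrier[OF L])
  have KsubL: "submodule R K ?L"
    using K KL modL by (auto simp: submodule_def)
  note modQ = quotient_module_module[OF KsubL]
    and modP = quotient_module_module[OF trace_filtration_submodule]
  let ?q = "\<lambda>x. K +>\<^bsub>?L\<^esub> x" and ?t = "\<lambda>x. ?T +>\<^bsub>N\<^esub> x"
  have surj: "?q ` carrier ?L = carrier ?Q" unfolding carrier_quotient_module ..
  note \<pi> = quotient_projection[OF trace_filtration_submodule[of i]]
  have t: "?t \<in> module_hom R ?L ?P"
    by (rule homI)
      (simp_all add: submodule_in_carrier[OF L] hom_in_carrier[OF \<pi>] hom_add[OF \<pi>] hom_smult[OF \<pi>])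
  have ker: "?t x = \<zero>\<^bsub>?P\<^esub>" if x: "x \<in> carrier ?L" "?q x = \<zero>\<^bsub>?Q\<^esub>" for x
  proof -
    have "x \<in> K" using coset_eq_zero_iff[OF KsubL x(1), THEN iffD1] x(2) by simp
    then have "x \<in> ?T" using KT by blast
    moreover have "x \<in> carrier N" using x(1) submodule_in_carrier[OF L] by simp
    ultimately show ?thesis
      unfolding zero_quotient_module
      by (intro coset_eq_zero_iff[OF trace_filtration_submodule, THEN iffD2])
  qed
  obtain g where g: "g \<in> module_hom R ?Q ?P" "\<And>x. x \<in> carrier ?L \<Longrightarrow> g (?q x) = ?t x"
    using factor_through_surjection[OF modL modQ modP quotient_projection[OF KsubL] surj t ker]
    by blast
  obtain k f where f: "f \<in> module_hom R (module_power M k) ?Q"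
    "f ` carrier (module_power M k) = carrier ?Q"
    using gen unfolding gen_def by blast
  fix x assume x: "x \<in> L"
  then have "?q x \<in> carrier ?Q" unfolding carrier_quotient_module by simp
  then obtain z where z: "z \<in> carrier (module_power M k)" "?q x = f z"
    unfolding f(2)[symmetric] by blast
  have "g (f z) \<in> trace_submodule R M ?P"
    by (rule power_hom_in_trace_submodule[OF finitely_presented_module[OF M] modP
          hom_compose[OF f(1) g(1)] z(1)])
  then have "?t x \<in> trace_submodule R M ?P" using g(2)[of x] x z(2) by simp
  then show "x \<in> trace_filtration R M N (Suc i)" using submodule_in_carrier[OF L x] by simp
qed

lemma Filt_gen_iff: "Filt R n (gen R M) N \<longleftrightarrow> trace_filtration R M N n = carrier N"
proof
  assume "Filt R n (gen R M) N"
  then obtain m F where F: "m \<le> n" "F 0 = {\<zero>\<^bsub>N\<^esub>}" "F m = carrier N"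
    "\<forall>i\<le>m. submodule R (F i) N \<and> finitely_presented R (N\<lparr>carrier := F i\<rparr>)"
    "\<forall>i<m. F i \<subseteq> F (Suc i) \<and> gen R M (quotient_module (N\<lparr>carrier := F (Suc i)\<rparr>) (F i))"
    unfolding Filt_def by (elim conjE exE)
  have "F i \<subseteq> trace_filtration R M N i" if "i \<le> m" for i
    using that
  proof (induction i)
    case (Suc i)
    then show ?case using F(4,5) by (intro gen_filtration_step_subset[of "F (Suc i)" "F i"]) simp_all
  qed (simp add: F(2))
  from this[of m] have "carrier N \<subseteq> trace_filtration R M N m" using F(3) by simp
  also have "\<dots> \<subseteq> trace_filtration R M N n" by (rule trace_filtration_mono[OF F(1)])
  finally show "trace_filtration R M N n = carrier N"
    using submodule_in_carrier[OF trace_filtration_submodule] by blast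
next
  assume "trace_filtration R M N n = carrier N"
  then show "Filt R n (gen R M) N"
    unfolding Filt_def
    by (intro conjI exI[of _ n] exI[of _ "trace_filtration R M N"] allI impI N order_refl
        trace_filtration_submodule trace_filtration_finitely_presented
        trace_filtration_Suc_mono trace_filtration_factor_gen) simp_all
qed

end

section \<open>The quotient by the annihilator\<close>

lemma regular_module_finitely_presented:
  assumes R: "coherent_ring R"
  shows "finitely_presented R (regular_module R)"
proof -
  let ?A = "regular_module R"
  note A = coherent_ring_coherent_module[OF R]
  note modA = coherent_moduleD(1)[OF A]
  have hom: "(\<lambda>x. x 0) \<in> module_hom R (free_module R 1) ?A" by (rule component_hom) simp
  have "(\<lambda>x. x 0) ` carrier (free_module R 1) = carrier ?A" (is "?I = _")
  proof
    show "?I \<subseteq> carrier ?A" using hom_in_carrier[OF hom] by blast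
    show "carrier ?A \<subseteq> ?I"
    proof
      fix r assume "r \<in> carrier ?A"
      then show "r \<in> ?I"
        by (intro image_eqI[OF _ coord_inj_in_carrier[OF modA, of r _ 0]])
          (simp_all add: coord_inj_def)
    qed
  qed
  then have "finitely_generated R ?A (carrier ?A)"
    using hom unfolding finitely_generated_def by blast
  from finitely_presented_restrict[OF A this] show ?thesis by (simp add: regular_module_def)
qed

text \<open>
  An element of \<open>R\<close> annihilates \<open>M\<close> once it annihilates finitely many generators, so the
  annihilator is the kernel of a homomorphism from \<open>R\<close> to a power of \<open>M\<close>.
\<close>

lemma annihilator_finitely_generated:
  assumes R: "coherent_ring R" and M: "finitely_presented R M"
  shows "finitely_generated R (regular_module R) (annihilator R M)"
proof -
  note modM = finitely_presented_module[OF M]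
  interpret M: Module.module R M by (rule modM)
  note reg = regular_module_finitely_presented[OF R]
  obtain n p where p: "p \<in> module_hom R (free_module R n) M"
    "p ` carrier (free_module R n) = carrier M"
    using finitely_presented_finitely_generated[OF M] by (rule finitely_generatedE)
  let ?x = "\<lambda>i. p (unit_vector R n i)"
  let ?\<phi> = "\<lambda>r. \<lambda>i\<in>{..<n}. r \<odot>\<^bsub>M\<^esub> ?x i"
  have x: "?x i \<in> carrier M" for i
    by (rule hom_in_carrier[OF p(1) unit_vector_in_carrier[OF M.R.is_cring]])
  have "(\<lambda>r. r \<odot>\<^bsub>M\<^esub> ?x i) \<in> module_hom R (regular_module R) M" for i
    by (rule homI) (simp_all add: x M.smult_l_distr M.smult_assoc1)
  then have \<phi>: "?\<phi> \<in> module_hom R (regular_module R) (module_power M n)"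
    by (intro hom_into_module_power modM)
  have "{r \<in> carrier (regular_module R). ?\<phi> r \<in> {\<zero>\<^bsub>module_power M n\<^esub>}} = annihilator R M"
    (is "?L = _")
  proof (rule subset_antisym; rule subsetI)
    fix r assume "r \<in> ?L"
    then have r: "r \<in> carrier R" and r0: "?\<phi> r = \<zero>\<^bsub>module_power M n\<^esub>" by auto
    have "r \<odot>\<^bsub>M\<^esub> p s = \<zero>\<^bsub>M\<^esub>" if s: "s \<in> carrier (free_module R n)" for s
    proof (rule free_hom_eqI[OF modM hom_smult_left[OF modM p(1) r] _ _ s])
      show "(\<lambda>s. \<zero>\<^bsub>M\<^esub>) \<in> module_hom R (free_module R n) M" by (rule homI) simp_all
      show "r \<odot>\<^bsub>M\<^esub> ?x i = \<zero>\<^bsub>M\<^esub>" if "i < n" for i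
        using fun_cong[OF r0, of i] that by simp
    qed
    then show "r \<in> annihilator R M"
      using r unfolding annihilator_def p(2)[symmetric] by blast
  next
    fix r assume "r \<in> annihilator R M"
    then have r: "r \<in> carrier R" "\<And>y. y \<in> carrier M \<Longrightarrow> r \<odot>\<^bsub>M\<^esub> y = \<zero>\<^bsub>M\<^esub>"
      by (auto simp: annihilator_def)
    then show "r \<in> ?L" by (simp add: x module_power_def)
  qed
  with finitely_generated_vimage[OF finitely_presented_module[OF reg]
      finitely_presented_finitely_generated[OF reg]
      coherent_module_power[OF finitely_presented_coherent_module[OF R M]] \<phi>
      finitely_generated_zero[OF module_power_module[OF modM]]]
  show ?thesis by simp
qed

theorem proposition4p4:
  fixes R :: "('a, 'r) ring_scheme" and M :: "('a, 'b, 'm) module_scheme"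
  assumes "coherent_ring R" and "finitely_presented R M"
  shows "(\<forall>N :: ('a, 'c, 'n) module_scheme. finitely_presented R N \<longrightarrow>
            (\<forall>i. finitely_presented R (N\<lparr>carrier := trace_filtration R M N i\<rparr>)) \<and>
            (\<forall>n\<ge>1. Filt R n (gen R M) N \<longleftrightarrow> trace_filtration R M N n = carrier N))
       \<and> gen_bound R M =
           Inf {enat n | n. n \<ge> 1 \<and>
             trace_filtration R M (quotient_module (regular_module R) (annihilator R M)) n =
               carrier (quotient_module (regular_module R) (annihilator R M))}"
proof -
  have "finitely_presented R (quotient_module (regular_module R) (annihilator R M))"
    by (rule finitely_presented_quotient[OF assms(1) regular_module_finitely_presented[OF assms(1)]
          annihilator_finitely_generated[OF assms]])
  then show ?thesis
    unfolding gen_bound_def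
    by (simp add: trace_filtration_finitely_presented[OF assms] Filt_gen_iff[OF assms])
qed

end
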